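(* Let $F_0$ be the solution of $F_0'' = -3Q(t)^2F_0$ for $t > 0$ with $F_0(0) = 0$, $F_0'(0) = -1$, and let $t_0 > 0$ be the first positive zero of $F_0$. Let $q$ solve $$q''(t) = -3Q(t+t_0)^2\,q(t), \quad t > 0, \qquad q(0) = 0,\ q'(0) = 1.$$ Then $q(t) > 0$ for all $0 < t < \infty$. Furthermore, there is a constant $c_0 > 0$ with $\min_{t \ge 1}\frac{q(t)}{t} \ge c_0$.
   Context: $Q(t)$, $t\ge 0$, denotes the radial profile of the positive radial ground state of $\Delta\phi - \phi + |\phi|^2\phi = 0$ on $\mathbb{R}^3$; it solves $-Q'' - \frac{2}{t}Q' + Q - Q^3 = 0$. The first positive zero $t_0$ of $F_0$ exists; this is the case $\epsilon = 0$ of the paper's sign-change lemma. *)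

theory Defs
  imports "HOL-Analysis.Analysis"
begin

text \<open>Radial profile of the positive radial ground state of
  Delta phi - phi + phi^3 = 0 on R^3: a positive, decaying C^2 solution on [0,inf) of
  -Q'' - (2/t) Q' + Q - Q^3 = 0 for t > 0, regular at the origin (Q'(0) = 0).
  Q' is given as dQ.\<close>
definition ground_state_profile :: "(real \<Rightarrow> real) \<Rightarrow> (real \<Rightarrow> real) \<Rightarrow> bool" where
  "ground_state_profile Q dQ \<longleftrightarrow>
     (\<forall>t\<ge>0. Q t > 0) \<and>
     continuous_on {0..} Q \<and> continuous_on {0..} dQ \<and>
     (\<forall>t\<ge>0. (Q has_real_derivative dQ t) (at t within {0..})) \<and>
     dQ 0 = 0 \<and>
     (\<forall>t>0. \<exists>d2. (dQ has_real_derivative d2) (at t) \<and>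
                 - d2 - (2 / t) * dQ t + Q t - Q t ^ 3 = 0) \<and>
     (Q \<longlongrightarrow> 0) at_top"

text \<open>f (with derivative df) solves f'' = -3 V(t)^2 f on t > 0, with f and f'
  continuous on [0,inf) so that the initial values f 0, df 0 are meaningful.\<close>
definition solves_lin_ode :: "(real \<Rightarrow> real) \<Rightarrow> (real \<Rightarrow> real) \<Rightarrow> (real \<Rightarrow> real) \<Rightarrow> bool" where
  "solves_lin_ode V f df \<longleftrightarrow>
     continuous_on {0..} f \<and> continuous_on {0..} df \<and>
     (\<forall>t>0. (f has_real_derivative df t) (at t)) \<and>
     (\<forall>t>0. (df has_real_derivative (-3 * V t ^ 2 * f t)) (at t))"

end

theory Submission
  imports Defs
begin

text \<open>
  Write u = tQ. The solution q is linearly bounded below as soon as f'' = -3 Q^2 f has a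
  supersolution w on [t0, \<infinity>) with 0 < m \<le> w \<le> 1 (Sturm comparison). Such a w is 1 - rQ^2 with r
  a suitable cubic. Two quantitative facts about Q are needed.

  Near the origin, u^2 lies between two polynomials in t^2 and -tQ'/Q. This makes u times an
  explicit factor a strict supersolution up to the first zero tau of that factor, so that
  tau \<le> t0.

  Near infinity, put zeta = 1 + u'/u and K = Q^2 - 2 zeta (2 - zeta); K is positive because an
  energy decreases. A deviation of K from the barriers 2 zeta / (gt + A - B zeta) on the wrong side
  would grow exponentially, which a decaying Q excludes. Both estimates together confine tau to the
  interval [0.41, 0.502] and bound zeta, so that the inequality satisfied by w reduces to polynomial
  inequalities in t and zeta.
\<close>

section \<open>Comparison on the real line\<close>

lemma last_crossing:
  fixes f :: "real \<Rightarrow> real"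
  assumes "a \<le> b" "continuous_on {a..b} f" "f a \<le> m" "m < f b"
  obtains c where "a \<le> c" "c < b" "f c = m" "\<And>x. c < x \<Longrightarrow> x \<le> b \<Longrightarrow> m < f x"
proof -
  define A where "A = {x \<in> {a..b}. f x \<le> m}"
  have "closed A"
    unfolding A_def using continuous_closed_preimage[OF assms(2) closed_atLeastAtMost, of "{..m}"]
    by (simp add: vimage_def Int_def conj_commute)
  moreover have "bounded A" by (rule bounded_subset[of "{a..b}"]) (auto simp: A_def)
  ultimately have "compact A" using compact_eq_bounded_closed by blast
  moreover have "a \<in> A" using assms by (auto simp: A_def)
  ultimately obtain c where c_props: "c \<in> A" "\<And>x. x \<in> A \<Longrightarrow> x \<le> c"
    using compact_attains_sup[of A] by blast
  have c_less_b: "c < b" using c_props(1) assms(4) by (cases "c = b") (auto simp: A_def)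
  have above: "m < f x" if "c < x" "x \<le> b" for x
    using c_props that by (fastforce simp: A_def)
  have "continuous_on {c..b} f"
    by (rule continuous_on_subset[OF assms(2)]) (use c_props in \<open>auto simp: A_def\<close>)
  then obtain x where x_props: "c \<le> x" "x \<le> b" "f x = m"
    using IVT'[of f c m b] c_props(1) assms(4) c_less_b by (auto simp: A_def)
  then have "x = c" using above[of x] by force
  then show thesis using that[of c] c_props(1) c_less_b above x_props by (auto simp: A_def)
qed

lemma first_zero:
  fixes f :: "real \<Rightarrow> real"
  assumes "a \<le> b" "continuous_on {a..b} f" "0 < f a" "f b \<le> 0"
  obtains c where "a < c" "c \<le> b" "f c = 0" "\<And>x. a \<le> x \<Longrightarrow> x < c \<Longrightarrow> 0 < f x"
proof -
  have "continuous_on {-b..-a} (\<lambda>x. f (- x))"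
    by (rule continuous_on_compose2[OF assms(2)]) (auto intro!: continuous_intros)
  then obtain c where "- b \<le> c" "c < - a" "f (- c) = 0"
      "\<And>x. c < x \<Longrightarrow> x \<le> - a \<Longrightarrow> 0 < f (- x)"
    using last_crossing[of "- b" "- a" "\<lambda>x. f (- x)" 0] assms by auto
  then show thesis using that[of "- c"]
    by (metis add.inverse_inverse le_minus_iff minus_le_iff minus_less_iff less_minus_iff)
qed

lemma le_if_nonincreasing_above:
  fixes f f' :: "real \<Rightarrow> real"
  assumes "a \<le> b" "continuous_on {a..b} f" "f a \<le> m"
    and "\<And>x. a < x \<Longrightarrow> x \<le> b \<Longrightarrow> (f has_real_derivative f' x) (at x)"
    and "\<And>x. a < x \<Longrightarrow> x \<le> b \<Longrightarrow> m < f x \<Longrightarrow> f' x \<le> 0"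
  shows "f b \<le> m"
proof (rule ccontr)
  assume "\<not> f b \<le> m"
  then have m_less_f_b: "m < f b" by simp
  then obtain c where c_props: "a \<le> c" "c < b" "f c = m" "\<And>x. c < x \<Longrightarrow> x \<le> b \<Longrightarrow> m < f x"
    using last_crossing[OF assms(1-3)] by metis
  have "f b \<le> f c"
  proof (rule DERIV_nonpos_imp_decreasing_open[of c b f])
    show "continuous_on {c..b} f"
      by (rule continuous_on_subset[OF assms(2)]) (use c_props in auto)
    show "\<exists>y. (f has_real_derivative y) (at x) \<and> y \<le> 0" if "c < x" "x < b" for x
      using assms(4)[of x] assms(5)[of x] c_props that by (intro exI[of _ "f' x"]) auto
  qed (use c_props in auto)
  then show False using c_props m_less_f_b by simp
qed

lemma le_if_decreasing_at_crossing:
  fixes f f' :: "real \<Rightarrow> real"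
  assumes "a \<le> b" "f a \<le> m"
    and deriv: "\<And>x. a \<le> x \<Longrightarrow> x \<le> b \<Longrightarrow> (f has_real_derivative f' x) (at x)"
    and neg: "\<And>x. a \<le> x \<Longrightarrow> x \<le> b \<Longrightarrow> f x = m \<Longrightarrow> f' x < 0"
  shows "f b \<le> m"
proof (rule ccontr)
  assume "\<not> f b \<le> m"
  then have m_less_f_b: "m < f b" by simp
  have cont: "continuous_on {a..b} f"
    by (rule DERIV_atLeastAtMost_imp_continuous_on) (use deriv in blast)
  obtain c where c_props: "a \<le> c" "c < b" "f c = m" "\<And>x. c < x \<Longrightarrow> x \<le> b \<Longrightarrow> m < f x"
    using last_crossing[OF assms(1) cont assms(2) m_less_f_b] by metis
  obtain d where d_props: "0 < d" "\<And>h. 0 < h \<Longrightarrow> h < d \<Longrightarrow> f (c + h) < f c"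
    using DERIV_neg_dec_right[OF deriv[of c] neg[of c]] c_props by auto
  define h where "h = min (d / 2) (b - c)"
  have "0 < h" "h < d" "c + h \<le> b" using d_props c_props by (auto simp: h_def min_def)
  then show False using d_props(2)[of h] c_props(3) c_props(4)[of "c + h"] by force
qed

lemma DERIV_ge_imp_linear_lower_bound:
  fixes f f' :: "real \<Rightarrow> real"
  assumes "a \<le> b"
    and "\<And>x. a \<le> x \<Longrightarrow> x \<le> b \<Longrightarrow> (f has_real_derivative f' x) (at x)"
    and "\<And>x. a \<le> x \<Longrightarrow> x \<le> b \<Longrightarrow> m \<le> f' x"
  shows "f a + m * (b - a) \<le> f b"
proof -
  have "f a - m * a \<le> f b - m * b"
  proof (rule DERIV_nonneg_imp_nondecreasing[OF assms(1), of "\<lambda>x. f x - m * x"])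
    fix x assume x_bounds: "a \<le> x" "x \<le> b"
    then have "((\<lambda>x. f x - m * x) has_real_derivative f' x - m) (at x)"
      by (auto intro!: derivative_eq_intros assms(2))
    then show "\<exists>y. ((\<lambda>x. f x - m * x) has_real_derivative y) (at x) \<and> 0 \<le> y"
      using assms(3)[OF x_bounds] by (intro exI[of _ "f' x - m"]) simp
  qed
  then show ?thesis by (simp add: algebra_simps)
qed

lemma DERIV_ge_pos_imp_unbounded:
  fixes f f' :: "real \<Rightarrow> real"
  assumes "0 < m"
    and "\<And>x. a \<le> x \<Longrightarrow> (f has_real_derivative f' x) (at x)"
    and "\<And>x. a \<le> x \<Longrightarrow> m \<le> f' x"
  obtains b where "a \<le> b" "B \<le> f b"
proof
  define b where "b = a + \<bar>B - f a\<bar> / m"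
  show "a \<le> b" using assms(1) by (simp add: b_def)
  then have "f a + m * (b - a) \<le> f b"
    using assms(2,3) by (intro DERIV_ge_imp_linear_lower_bound) auto
  moreover have "m * (b - a) = \<bar>B - f a\<bar>" using assms(1) by (simp add: b_def)
  ultimately show "B \<le> f b" by linarith
qed

lemma pos_if_DERIV_ge_mult:
  fixes f f' :: "real \<Rightarrow> real"
  assumes "a \<le> b" "0 < f a"
    and deriv: "\<And>x. a \<le> x \<Longrightarrow> x \<le> b \<Longrightarrow> (f has_real_derivative f' x) (at x)"
    and deriv_ge: "\<And>x. a \<le> x \<Longrightarrow> x \<le> b \<Longrightarrow> 0 < f x \<Longrightarrow> - M * f x \<le> f' x"
  shows "0 < f b"
proof (rule ccontr)
  assume "\<not> 0 < f b"
  have cont: "continuous_on {a..b} f"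
    by (rule DERIV_atLeastAtMost_imp_continuous_on) (use deriv in blast)
  then obtain c where c_props: "a < c" "c \<le> b" "f c = 0" "\<And>x. a \<le> x \<Longrightarrow> x < c \<Longrightarrow> 0 < f x"
    using first_zero[of a b f] assms(1,2) \<open>\<not> 0 < f b\<close> by (auto simp: not_less)
  let ?g = "\<lambda>x. f x * exp (M * x)"
  have "?g a \<le> ?g c"
  proof (rule DERIV_nonneg_imp_increasing_open[of a c ?g])
    fix x assume x_bounds: "a < x" "x < c"
    have "(?g has_real_derivative (f' x + M * f x) * exp (M * x)) (at x)"
      by (rule derivative_eq_intros deriv refl | use x_bounds c_props in \<open>simp add: algebra_simps\<close>)+
    moreover have "0 \<le> (f' x + M * f x) * exp (M * x)"
      using deriv_ge[of x] c_props(2) c_props(4)[of x] x_bounds by simp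
    ultimately show "\<exists>y. (?g has_real_derivative y) (at x) \<and> 0 \<le> y" by blast
  next
    show "continuous_on {a..c} ?g"
      by (intro continuous_intros continuous_on_subset[OF cont]) (use c_props in auto)
  qed (use c_props in auto)
  moreover have "0 < ?g a" using assms(2) by simp
  ultimately show False using c_props(3) by simp
qed

lemma bounded_imp_nonpos_if_DERIV_ge_mult:
  fixes f f' g :: "real \<Rightarrow> real"
  assumes deriv: "\<And>t. a \<le> t \<Longrightarrow> (f has_real_derivative f' t) (at t)"
    and deriv_ge: "\<And>t. a \<le> t \<Longrightarrow> 0 < f t \<Longrightarrow> g t * f t \<le> f' t"
    and rate_ge: "\<And>t. a \<le> t \<Longrightarrow> - M \<le> g t"
    and late: "\<And>t. T \<le> t \<Longrightarrow> 1 \<le> g t"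
    and bounded: "\<And>t. a \<le> t \<Longrightarrow> f t \<le> B"
  shows "f a \<le> 0"
proof (rule ccontr)
  assume "\<not> f a \<le> 0"
  then have f_a_pos: "0 < f a" by simp
  have pos: "0 < f t" if "a \<le> t" for t
  proof (rule pos_if_DERIV_ge_mult[where f = f and f' = f' and M = M, OF that f_a_pos])
    fix x assume x_bounds: "a \<le> x" "x \<le> t" "0 < f x"
    then have "- M * f x \<le> g x * f x" using rate_ge[of x] by (intro mult_right_mono) auto
    then show "- M * f x \<le> f' x" using deriv_ge[of x] x_bounds by simp
  qed (use deriv in auto)
  define s where "s = max T a"
  have s_bounds: "a \<le> s" "T \<le> s" by (auto simp: s_def)
  have f_le_deriv: "f t \<le> f' t" if s_le_t: "s \<le> t" for t
  proof -
    have "1 * f t \<le> g t * f t"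
      using late[of t] pos[of t] s_bounds s_le_t by (intro mult_right_mono) auto
    also have "\<dots> \<le> f' t" using deriv_ge[of t] pos[of t] s_bounds s_le_t by simp
    finally show ?thesis by simp
  qed
  have f_s_le: "f s \<le> f' t" if s_le_t: "s \<le> t" for t
  proof -
    have "f s + 0 * (t - s) \<le> f t"
    proof (rule DERIV_ge_imp_linear_lower_bound[OF s_le_t])
      show "0 \<le> f' x" if "s \<le> x" for x using f_le_deriv[OF that] pos[of x] s_bounds that by simp
    qed (use deriv s_bounds in auto)
    then show ?thesis using f_le_deriv[OF s_le_t] by simp
  qed
  obtain t where "s \<le> t" "B + 1 \<le> f t"
    using DERIV_ge_pos_imp_unbounded[of "f s" s f f' "B + 1"] pos[of s] deriv f_s_le s_bounds
    by auto
  then show False using bounded[of t] s_bounds by simp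
qed

lemma nonpos_near_singular_point:
  fixes f f' g :: "real \<Rightarrow> real"
  assumes "0 < T" and cont: "continuous_on {0..T} f" "continuous_on {0..T} g"
    and init: "f 0 \<le> 0" "g 0 < 0"
    and deriv: "\<And>t. 0 < t \<Longrightarrow> t \<le> T \<Longrightarrow> (f has_real_derivative f' t) (at t)"
    and ineq: "\<And>t. 0 < t \<Longrightarrow> t \<le> T \<Longrightarrow> 0 < f t \<Longrightarrow> t * f' t \<le> g t * f t"
  obtains d where "0 < d" "\<And>t. 0 < t \<Longrightarrow> t < d \<Longrightarrow> t \<le> T \<Longrightarrow> f t \<le> 0"
proof -
  have "(g \<longlongrightarrow> g 0) (at 0 within {0..T})"
    using cont(2) \<open>0 < T\<close> by (auto simp: continuous_on_def)
  then have "eventually (\<lambda>x. g x < 0) (at 0 within {0..T})"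
    using init(2) by (rule order_tendstoD(2))
  then obtain d where d_props: "0 < d" "\<And>x. x \<in> {0..T} \<Longrightarrow> x \<noteq> 0 \<Longrightarrow> dist x 0 < d \<Longrightarrow> g x < 0"
    by (auto simp: eventually_at)
  have "f t \<le> 0" if t_bounds: "0 < t" "t < d" "t \<le> T" for t
  proof (rule le_if_nonincreasing_above[of 0 t f 0 f'])
    show "continuous_on {0..t} f" by (rule continuous_on_subset[OF cont(1)]) (use t_bounds in auto)
    fix x assume x_bounds: "0 < x" "x \<le> t"
    show "(f has_real_derivative f' x) (at x)" using deriv[of x] x_bounds t_bounds by auto
    assume f_x_pos: "0 < f x"
    then have "g x * f x < 0" using d_props(2)[of x] x_bounds t_bounds by (intro mult_neg_pos) auto
    then have "x * f' x < 0" using ineq[of x] x_bounds t_bounds f_x_pos by auto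
    then show "f' x \<le> 0" using x_bounds by (simp add: mult_less_0_iff)
  qed (use t_bounds init in auto)
  then show thesis using that d_props(1) by blast
qed

text \<open>The quotient \<open>f / t ^ n\<close> cannot become positive.\<close>

lemma nonpos_if_DERIV_le_mult_div:
  fixes f f' :: "real \<Rightarrow> real" and n :: nat
  assumes "0 < a" "a \<le> b" "f a \<le> 0"
    and deriv: "\<And>x. a \<le> x \<Longrightarrow> x \<le> b \<Longrightarrow> (f has_real_derivative f' x) (at x)"
    and ineq: "\<And>x. a \<le> x \<Longrightarrow> x \<le> b \<Longrightarrow> 0 < f x \<Longrightarrow> x * f' x \<le> real n * f x"
  shows "f b \<le> 0"
proof -
  have "f b / b ^ n \<le> 0"
  proof (rule le_if_nonincreasing_above[of a b "\<lambda>x. f x / x ^ n" 0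
        "\<lambda>x. (x * f' x - real n * f x) / x ^ Suc n"])
    have "continuous_on {a..b} f"
      by (rule DERIV_atLeastAtMost_imp_continuous_on) (use deriv in blast)
    then show "continuous_on {a..b} (\<lambda>x. f x / x ^ n)"
      using assms(1) by (intro continuous_intros) auto
    show "f a / a ^ n \<le> 0" using assms(1,3) by (simp add: divide_nonpos_pos)
    fix x assume x_bounds: "a < x" "x \<le> b"
    show "((\<lambda>x. f x / x ^ n) has_real_derivative (x * f' x - real n * f x) / x ^ Suc n) (at x)"
    proof (rule DERIV_cong[OF DERIV_divide])
      show "(f has_real_derivative f' x) (at x)" using deriv x_bounds by simp
      show "((\<lambda>x. x ^ n) has_real_derivative real n * x ^ (n - 1)) (at x)"
        using DERIV_pow[of n x] by simp
      show "x ^ n \<noteq> 0" using x_bounds assms(1) by simp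
      show "(f' x * x ^ n - f x * (real n * x ^ (n - 1))) / (x ^ n * x ^ n)
          = (x * f' x - real n * f x) / x ^ Suc n"
        using x_bounds assms(1) by (cases n) (simp_all add: field_simps)
    qed
    assume "0 < f x / x ^ n"
    then have "0 < f x" using x_bounds assms(1) by (simp add: zero_less_divide_iff)
    then show "(x * f' x - real n * f x) / x ^ Suc n \<le> 0"
      using ineq[of x] x_bounds assms(1) by (intro divide_nonpos_pos) auto
  qed (use assms in auto)
  then show ?thesis using assms(1,2) by (simp add: pos_divide_le_eq)
qed

lemma nonpos_if_singular_differential_inequality:
  fixes f f' g :: "real \<Rightarrow> real"
  assumes cont: "continuous_on {0..T} f" "continuous_on {0..T} g"
    and init: "f 0 \<le> 0" "g 0 < 0"
    and deriv: "\<And>t. 0 < t \<Longrightarrow> t \<le> T \<Longrightarrow> (f has_real_derivative f' t) (at t)"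
    and ineq: "\<And>t. 0 < t \<Longrightarrow> t \<le> T \<Longrightarrow> 0 < f t \<Longrightarrow> t * f' t \<le> g t * f t"
    and t_bounds: "0 < t" "t \<le> T"
  shows "f t \<le> 0"
proof -
  have "0 < T" using t_bounds by simp
  from nonpos_near_singular_point[OF this cont init deriv ineq]
  obtain d where d_props: "0 < d" "\<And>x. 0 < x \<Longrightarrow> x < d \<Longrightarrow> x \<le> T \<Longrightarrow> f x \<le> 0" by blast
  define e where "e = min (d / 2) t"
  have e_bounds: "0 < e" "e \<le> t" "e < d" using d_props(1) t_bounds by (auto simp: e_def min_def)
  have "bounded (g ` {0..T})"
    by (intro compact_imp_bounded compact_continuous_image cont) auto
  then obtain B where g_le_B: "\<forall>x\<in>{0..T}. \<bar>g x\<bar> \<le> B" by (auto simp: bounded_iff)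
  obtain n :: nat where B_le_n: "B \<le> real n" using real_arch_simple by blast
  show ?thesis
  proof (rule nonpos_if_DERIV_le_mult_div[OF e_bounds(1,2)])
    show "f e \<le> 0" using d_props(2)[of e] e_bounds t_bounds by simp
    fix x assume x_bounds: "e \<le> x" "x \<le> t"
    show "(f has_real_derivative f' x) (at x)" using deriv x_bounds e_bounds t_bounds by simp
    assume f_x_pos: "0 < f x"
    have "x * f' x \<le> g x * f x" using ineq x_bounds e_bounds t_bounds f_x_pos by simp
    also have "\<dots> \<le> real n * f x"
      using g_le_B[rule_format, of x] B_le_n x_bounds e_bounds t_bounds f_x_pos
      by (intro mult_right_mono) auto
    finally show "x * f' x \<le> real n * f x" .
  qed
qed

section \<open>Sturm comparison\<close>

lemma solves_lin_odeD:
  assumes "solves_lin_ode V f df"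
  shows "continuous_on {0..} f" "continuous_on {0..} df"
    and "0 < t \<Longrightarrow> (f has_real_derivative df t) (at t)"
    and "0 < t \<Longrightarrow> (df has_real_derivative - 3 * (V t)\<^sup>2 * f t) (at t)"
  using assms by (auto simp: solves_lin_ode_def)

lemma solves_lin_ode_uminus:
  assumes "solves_lin_ode V f df"
  shows "solves_lin_ode V (\<lambda>t. - f t) (\<lambda>t. - df t)"
  using assms unfolding solves_lin_ode_def
  by (auto intro!: continuous_intros derivative_eq_intros)

lemma solves_lin_ode_pos_near_0:
  assumes ode: "solves_lin_ode V f df" and init: "f 0 = 0" "0 < df 0"
  obtains d where "0 < d" "\<And>t. 0 < t \<Longrightarrow> t < d \<Longrightarrow> 0 < f t"
proof -
  have "(df \<longlongrightarrow> df 0) (at 0 within {0..})"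
    using solves_lin_odeD(2)[OF ode] by (auto simp: continuous_on_def)
  then have "eventually (\<lambda>t. 0 < df t) (at 0 within {0..})"
    using init(2) by (rule order_tendstoD(1))
  then obtain d where d_props: "0 < d" "\<And>t. 0 \<le> t \<Longrightarrow> t \<noteq> 0 \<Longrightarrow> dist t 0 < d \<Longrightarrow> 0 < df t"
    by (auto simp: eventually_at)
  have "0 < f t" if t_bounds: "0 < t" "t < d" for t
  proof -
    have "f 0 < f t"
    proof (rule DERIV_pos_imp_increasing_open[OF t_bounds(1)])
      show "\<exists>y. (f has_real_derivative y) (at x) \<and> 0 < y" if "0 < x" "x < t" for x
        using solves_lin_odeD(3)[OF ode, of x] d_props(2)[of x] that t_bounds by auto
      show "continuous_on {0..t} f"
        by (rule continuous_on_subset[OF solves_lin_odeD(1)[OF ode]]) auto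
    qed
    then show ?thesis using init by simp
  qed
  then show thesis using that d_props(1) by blast
qed

lemma solves_lin_ode_first_zero:
  assumes ode: "solves_lin_ode V f df" and init: "f 0 = 0" "0 < df 0"
    and t_bounds: "0 < t" "f t \<le> 0"
  obtains s where "0 < s" "s \<le> t" "f s = 0" "\<And>x. 0 < x \<Longrightarrow> x < s \<Longrightarrow> 0 < f x"
proof -
  obtain d where d_props: "0 < d" "\<And>x. 0 < x \<Longrightarrow> x < d \<Longrightarrow> 0 < f x"
    using solves_lin_ode_pos_near_0[OF ode init] by blast
  define e where "e = min (d / 2) t"
  have e_bounds: "0 < e" "e \<le> t" "e < d" using d_props(1) t_bounds by (auto simp: e_def min_def)
  have "continuous_on {e..t} f"
    by (rule continuous_on_subset[OF solves_lin_odeD(1)[OF ode]]) (use e_bounds in auto)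
  then obtain s where "e < s" "s \<le> t" "f s = 0" "\<And>x. e \<le> x \<Longrightarrow> x < s \<Longrightarrow> 0 < f x"
    using first_zero[of e t f] d_props(2)[of e] e_bounds t_bounds by blast
  then show thesis
    using that[of s] d_props(2) e_bounds by (metis less_trans not_le order.strict_trans2)
qed

lemma solves_lin_ode_wronskian:
  assumes ode: "solves_lin_ode V f df" and "0 < t"
    and "(w has_real_derivative dw t) (at t)" "(dw has_real_derivative ddw) (at t)"
  shows "((\<lambda>t. df t * w t - f t * dw t) has_real_derivative
    - (f t * (ddw + 3 * (V t)\<^sup>2 * w t))) (at t)"
  by (rule DERIV_cong, (rule derivative_intros solves_lin_odeD(3,4)[OF ode assms(2)] assms(3,4))+)
    (simp add: algebra_simps)

lemma first_zero_ge_if_strict_supersolution: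
  fixes p dp ddp :: "real \<Rightarrow> real"
  assumes ode: "solves_lin_ode V f df" and init: "f 0 = 0" "0 < df 0"
    and zero: "0 < s" "f s = 0" "\<And>t. 0 < t \<Longrightarrow> t < s \<Longrightarrow> f t \<noteq> 0"
    and p_props: "continuous_on {0..} p" "continuous_on {0..} dp" "p 0 = 0"
      "\<And>t. 0 < t \<Longrightarrow> (p has_real_derivative dp t) (at t)"
      "\<And>t. 0 < t \<Longrightarrow> (dp has_real_derivative ddp t) (at t)"
    and super: "\<And>t. 0 < t \<Longrightarrow> t < b \<Longrightarrow> 0 < p t"
      "\<And>t. 0 < t \<Longrightarrow> t < b \<Longrightarrow> ddp t + 3 * (V t)\<^sup>2 * p t < 0"
  shows "b \<le> s"
proof (rule ccontr)
  assume "\<not> b \<le> s"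
  then have s_less_b: "s < b" by simp
  obtain s' where "0 < s'" "s' \<le> s" "f s' = 0" "\<And>x. 0 < x \<Longrightarrow> x < s' \<Longrightarrow> 0 < f x"
    using solves_lin_ode_first_zero[OF ode init zero(1)] zero(2) by (metis order_refl)
  then have pos: "0 < f x" if "0 < x" "x < s" for x
    using zero(3)[of s'] that by fastforce
  let ?W = "\<lambda>t. df t * p t - f t * dp t"
  have "?W 0 < ?W s"
  proof (rule DERIV_pos_imp_increasing_open[OF zero(1)])
    fix x assume x_bounds: "0 < x" "x < s"
    then have "f x * (ddp x + 3 * (V x)\<^sup>2 * p x) < 0"
      using super(2)[of x] pos s_less_b by (intro mult_pos_neg) auto
    then show "\<exists>y. (?W has_real_derivative y) (at x) \<and> 0 < y"
      using solves_lin_ode_wronskian[OF ode x_bounds(1) p_props(4,5)[OF x_bounds(1)]] by force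
  next
    show "continuous_on {0..s} ?W"
      by (intro continuous_intros continuous_on_subset[OF solves_lin_odeD(1)[OF ode]]
          continuous_on_subset[OF solves_lin_odeD(2)[OF ode]]
          continuous_on_subset[OF p_props(1)] continuous_on_subset[OF p_props(2)]) auto
  qed
  then have "0 < df s * p s" using init p_props(3) zero(2) by simp
  then have "0 < df s" using super(1)[of s] zero(1) s_less_b by (simp add: zero_less_mult_iff)
  then obtain e where e_props: "0 < e" "\<And>h. 0 < h \<Longrightarrow> h < e \<Longrightarrow> f (s - h) < f s"
    using DERIV_pos_inc_left[OF solves_lin_odeD(3)[OF ode zero(1)]] by blast
  define h where "h = min (e / 2) (s / 2)"
  have "0 < h" "h < e" "h < s" using e_props zero(1) by (auto simp: h_def min_def)
  then show False using e_props(2)[of h] pos[of "s - h"] zero(2) by auto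
qed

lemma solves_lin_ode_wronskian_ge:
  fixes w dw ddw :: "real \<Rightarrow> real"
  assumes ode: "solves_lin_ode V f df" and init: "f 0 = 0" "df 0 = 1"
    and w_regular: "continuous_on {0..} w" "continuous_on {0..} dw"
      "\<And>t. 0 < t \<Longrightarrow> (w has_real_derivative dw t) (at t)"
      "\<And>t. 0 < t \<Longrightarrow> (dw has_real_derivative ddw t) (at t)"
    and super: "\<And>t. 0 < t \<Longrightarrow> ddw t + 3 * (V t)\<^sup>2 * w t \<le> 0"
    and "0 \<le> s" and pos: "\<And>t. 0 < t \<Longrightarrow> t < s \<Longrightarrow> 0 < f t"
  shows "w 0 \<le> df s * w s - f s * dw s"
proof -
  let ?W = "\<lambda>t. df t * w t - f t * dw t"
  have "?W 0 \<le> ?W s"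
  proof (rule DERIV_nonneg_imp_increasing_open[OF \<open>0 \<le> s\<close>, of ?W])
    show "continuous_on {0..s} ?W"
      by (intro continuous_intros solves_lin_odeD(1,2)[OF ode, THEN continuous_on_subset]
          w_regular(1,2)[THEN continuous_on_subset]) auto
    fix x assume x_bounds: "0 < x" "x < s"
    have "f x * (ddw x + 3 * (V x)\<^sup>2 * w x) \<le> 0"
      using pos[OF x_bounds] super[OF x_bounds(1)] by (intro mult_nonneg_nonpos) auto
    then show "\<exists>y. (?W has_real_derivative y) (at x) \<and> 0 \<le> y"
      using solves_lin_ode_wronskian[OF ode x_bounds(1) w_regular(3,4)[OF x_bounds(1)]] by force
  qed
  then show ?thesis using init by simp
qed

lemma solves_lin_ode_ratio_growth:
  fixes w dw ddw :: "real \<Rightarrow> real"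
  assumes ode: "solves_lin_ode V f df" and init: "f 0 = 0" "df 0 = 1"
    and w_regular: "continuous_on {0..} w" "continuous_on {0..} dw"
      "\<And>t. 0 < t \<Longrightarrow> (w has_real_derivative dw t) (at t)"
      "\<And>t. 0 < t \<Longrightarrow> (dw has_real_derivative ddw t) (at t)"
    and super: "\<And>t. 0 < t \<Longrightarrow> ddw t + 3 * (V t)\<^sup>2 * w t \<le> 0"
    and bounds: "0 < m" "\<And>t. 0 \<le> t \<Longrightarrow> m \<le> w t" "\<And>t. 0 \<le> t \<Longrightarrow> w t \<le> 1"
    and "0 \<le> s" and pos: "\<And>t. 0 < t \<Longrightarrow> t < s \<Longrightarrow> 0 < f t"
  shows "m * s \<le> f s / w s"
proof -
  let ?W = "\<lambda>t. df t * w t - f t * dw t"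
  have w_pos: "0 < w t" if "0 \<le> t" for t using bounds(1,2) that by force
  have "f 0 / w 0 - m * 0 \<le> f s / w s - m * s"
  proof (rule DERIV_nonneg_imp_increasing_open[OF \<open>0 \<le> s\<close>, of "\<lambda>x. f x / w x - m * x"])
    show "continuous_on {0..s} (\<lambda>x. f x / w x - m * x)"
      by (intro continuous_intros solves_lin_odeD(1)[OF ode, THEN continuous_on_subset]
          w_regular(1)[THEN continuous_on_subset]) (use w_pos in force)+
    fix x assume x_bounds: "0 < x" "x < s"
    have w_x_bounds: "0 < w x" "w x \<le> 1" using w_pos[of x] bounds(3)[of x] x_bounds by auto
    have "m \<le> w 0" using bounds(2) by simp
    also have "w 0 \<le> ?W x"
      using pos x_bounds by (intro solves_lin_ode_wronskian_ge[OF ode init w_regular super]) auto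
    finally have "m * (w x * w x) \<le> ?W x * 1"
      using w_x_bounds bounds(1) by (intro mult_mono) (auto simp: mult_le_one)
    then have "m \<le> ?W x / (w x * w x)" using w_x_bounds by (simp add: pos_le_divide_eq)
    moreover have "((\<lambda>x. f x / w x - m * x) has_real_derivative ?W x / (w x * w x) - m) (at x)"
      using w_x_bounds solves_lin_odeD(3)[OF ode x_bounds(1)] w_regular(3)[OF x_bounds(1)]
      by (auto intro!: derivative_eq_intros)
    ultimately show "\<exists>y. ((\<lambda>x. f x / w x - m * x) has_real_derivative y) (at x) \<and> 0 \<le> y"
      by (intro exI[of _ "?W x / (w x * w x) - m"]) simp
  qed
  then show ?thesis using init by simp
qed

lemma linear_growth_if_supersolution:
  fixes w dw ddw :: "real \<Rightarrow> real"
  assumes ode: "solves_lin_ode V f df" and init: "f 0 = 0" "df 0 = 1"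
    and w_regular: "continuous_on {0..} w" "continuous_on {0..} dw"
      "\<And>t. 0 < t \<Longrightarrow> (w has_real_derivative dw t) (at t)"
      "\<And>t. 0 < t \<Longrightarrow> (dw has_real_derivative ddw t) (at t)"
    and super: "\<And>t. 0 < t \<Longrightarrow> ddw t + 3 * (V t)\<^sup>2 * w t \<le> 0"
    and bounds: "0 < m" "\<And>t. 0 \<le> t \<Longrightarrow> m \<le> w t" "\<And>t. 0 \<le> t \<Longrightarrow> w t \<le> 1"
    and t_pos: "0 < t"
  shows "m\<^sup>2 * t \<le> f t"
proof -
  note ratio = solves_lin_ode_ratio_growth[OF ode init w_regular super bounds]
  have pos: "0 < f x" if x_pos: "0 < x" for x
  proof (rule ccontr)
    assume "\<not> 0 < f x"
    then obtain s where s_props: "0 < s" "f s = 0" "\<And>r. 0 < r \<Longrightarrow> r < s \<Longrightarrow> 0 < f r"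
      using solves_lin_ode_first_zero[OF ode init(1) _ x_pos] init(2) by auto
    then have "m * s \<le> 0" using ratio[of s] by simp
    then show False using s_props(1) bounds(1) by (simp add: mult_le_0_iff)
  qed
  have w_t_ge: "m \<le> w t" using bounds(2) t_pos by simp
  have "m * t \<le> f t / w t" using ratio[of t] pos t_pos by simp
  then have "m * t * w t \<le> f t" using w_t_ge bounds(1) by (simp add: pos_le_divide_eq)
  moreover have "m * t * m \<le> m * t * w t"
    using bounds(1) w_t_ge t_pos by (intro mult_left_mono) auto
  ultimately show ?thesis by (simp add: power2_eq_square mult_ac)
qed

section \<open>The ground state\<close>

locale ground_state =
  fixes Q dQ :: "real \<Rightarrow> real"
  assumes profile: "ground_state_profile Q dQ"
begin

lemma Q_pos: "0 \<le> t \<Longrightarrow> 0 < Q t"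
  using profile by (auto simp: ground_state_profile_def)

lemma Q_deriv: assumes "0 < t" shows "(Q has_real_derivative dQ t) (at t)"
proof -
  have "(Q has_real_derivative dQ t) (at t within {0..})"
    using profile assms by (simp add: ground_state_profile_def)
  moreover have "at t within {0..} = at t"
    using assms by (intro at_within_interior) simp
  ultimately show ?thesis by simp
qed

lemma dQ_deriv:
  assumes "0 < t" shows "(dQ has_real_derivative Q t - Q t ^ 3 - 2 * dQ t / t) (at t)"
proof -
  obtain d where d_props: "(dQ has_real_derivative d) (at t)"
      "- d - (2 / t) * dQ t + Q t - Q t ^ 3 = 0"
    using profile assms by (auto simp: ground_state_profile_def)
  then have "d = Q t - Q t ^ 3 - 2 * dQ t / t" by (simp add: field_simps)
  then show ?thesis using d_props by simp
qed

lemma Q_cont: "continuous_on {0..} Q" and dQ_cont: "continuous_on {0..} dQ"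
  and dQ_0: "dQ 0 = 0" and Q_lim: "(Q \<longlongrightarrow> 0) at_top"
  using profile by (auto simp: ground_state_profile_def)

lemma Q_eventually_less:
  assumes "0 < e" obtains T where "0 < T" "\<And>t. T \<le> t \<Longrightarrow> Q t < e"
proof -
  have "eventually (\<lambda>t. Q t < e) at_top" using order_tendstoD(2)[OF Q_lim assms] .
  then obtain T where "\<And>t. T \<le> t \<Longrightarrow> Q t < e" by (auto simp: eventually_at_top_linorder)
  then show thesis using that[of "max T 1"] by auto
qed

lemma Q_sq_eventually_less:
  assumes "0 < e" obtains T where "0 < T" "\<And>t. T \<le> t \<Longrightarrow> (Q t)\<^sup>2 < e"
proof -
  obtain T where T_props: "0 < T" "\<And>t. T \<le> t \<Longrightarrow> Q t < sqrt e"
    using Q_eventually_less[of "sqrt e"] assms by auto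
  have "(Q t)\<^sup>2 < (sqrt e)\<^sup>2" if "T \<le> t" for t
    using T_props(2)[OF that] Q_pos[of t] T_props(1) that by (intro power_strict_mono) auto
  then show thesis using that T_props(1) assms by simp
qed

definition energy where "energy t = 2 * (dQ t)\<^sup>2 - 2 * (Q t)\<^sup>2 + Q t ^ 4"

lemma energy_antimono:
  assumes "0 \<le> s" "s \<le> t" shows "energy t \<le> energy s"
proof (rule DERIV_nonpos_imp_decreasing_open[OF assms(2)])
  fix x assume x_bounds: "s < x" "x < t"
  then have "0 < x" using assms by simp
  then have "(energy has_real_derivative - 8 * (dQ x)\<^sup>2 / x) (at x)"
    unfolding energy_def[abs_def]
    by (auto intro!: derivative_eq_intros Q_deriv dQ_deriv
        simp: field_simps power2_eq_square power3_eq_cube)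
  moreover have "- 8 * (dQ x)\<^sup>2 / x \<le> 0" using \<open>0 < x\<close> by (simp add: divide_nonpos_pos)
  ultimately show "\<exists>y. (energy has_real_derivative y) (at x) \<and> y \<le> 0" by blast
next
  show "continuous_on {s..t} energy"
    unfolding energy_def[abs_def] using assms
    by (intro continuous_intros continuous_on_subset[OF Q_cont] continuous_on_subset[OF dQ_cont]) auto
qed

lemma energy_nonneg: assumes "0 \<le> t" shows "0 \<le> energy t"
proof (rule ccontr)
  assume neg: "\<not> 0 \<le> energy t"
  obtain T where T_props: "0 < T" "\<And>s. T \<le> s \<Longrightarrow> (Q s)\<^sup>2 < - energy t / 2"
    using Q_sq_eventually_less[of "- energy t / 2"] neg by auto
  define s where "s = max T t"
  have "(Q s)\<^sup>2 < - energy t / 2" "energy s \<le> energy t"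
    using T_props energy_antimono[of t s] assms by (auto simp: s_def)
  moreover have "0 \<le> (dQ s)\<^sup>2" "0 \<le> Q s ^ 4" by simp_all
  ultimately show False unfolding energy_def[of s] by linarith
qed

lemma Q_sq_ge_2_if_critical:
  assumes "0 \<le> t" "dQ t = 0" shows "2 \<le> (Q t)\<^sup>2"
proof -
  have "0 \<le> (Q t)\<^sup>2 * ((Q t)\<^sup>2 - 2)"
    using energy_nonneg[OF assms(1)] assms(2)
    by (simp add: energy_def power4_eq_xxxx power2_eq_square algebra_simps)
  then show ?thesis using Q_pos[OF assms(1)] by (simp add: zero_le_mult_iff)
qed

lemma dQ_neg_while_Q_gt_1:
  assumes "0 < t" "\<And>x. 0 < x \<Longrightarrow> x < t \<Longrightarrow> 1 < (Q x)\<^sup>2" shows "dQ t < 0"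
proof -
  have "t\<^sup>2 * dQ t < 0\<^sup>2 * dQ 0"
  proof (rule DERIV_neg_imp_decreasing_open[OF assms(1), of "\<lambda>t. t\<^sup>2 * dQ t"])
    fix x assume x_bounds: "0 < x" "x < t"
    have "((\<lambda>t. t\<^sup>2 * dQ t) has_real_derivative x\<^sup>2 * (Q x * (1 - (Q x)\<^sup>2))) (at x)"
      using x_bounds by (auto intro!: derivative_eq_intros dQ_deriv
          simp: field_simps power2_eq_square power3_eq_cube)
    moreover have "x\<^sup>2 * (Q x * (1 - (Q x)\<^sup>2)) < 0"
      using x_bounds Q_pos[of x] assms(2)[OF x_bounds] by (intro mult_pos_neg mult_pos_neg) auto
    ultimately show "\<exists>y. ((\<lambda>t. t\<^sup>2 * dQ t) has_real_derivative y) (at x) \<and> y < 0" by blast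
  next
    show "continuous_on {0..t} (\<lambda>t. t\<^sup>2 * dQ t)"
      by (intro continuous_intros continuous_on_subset[OF dQ_cont]) auto
  qed
  then show ?thesis using assms(1) by (simp add: mult_less_0_iff)
qed

lemma ddQ_neg_if_critical:
  assumes "0 < t" "dQ t = 0" shows "Q t - Q t ^ 3 - 2 * dQ t / t < 0"
proof -
  have "Q t * (1 - (Q t)\<^sup>2) < 0"
    using Q_pos[of t] Q_sq_ge_2_if_critical[of t] assms by (intro mult_pos_neg) auto
  then show ?thesis using assms by (simp add: power2_eq_square power3_eq_cube algebra_simps)
qed

text \<open>Q decreases initially and, having a nonnegative energy, is strictly concave at every
  critical point.\<close>

lemma dQ_neg: assumes "0 < t" shows "dQ t < 0"
proof -
  have "((\<lambda>x. (Q x)\<^sup>2) \<longlongrightarrow> (Q 0)\<^sup>2) (at 0 within {0..})"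
    using Q_cont by (intro tendsto_power) (auto simp: continuous_on_def)
  moreover have "1 < (Q 0)\<^sup>2" using Q_sq_ge_2_if_critical[of 0] dQ_0 by simp
  ultimately have "eventually (\<lambda>x. 1 < (Q x)\<^sup>2) (at 0 within {0..})" by (rule order_tendstoD(1))
  then obtain d where d_props: "0 < d" "\<And>x. 0 \<le> x \<Longrightarrow> x \<noteq> 0 \<Longrightarrow> dist x 0 < d \<Longrightarrow> 1 < (Q x)\<^sup>2"
    by (auto simp: eventually_at)
  have nonpos: "dQ s \<le> 0" if s_pos: "0 < s" for s
  proof (rule le_if_decreasing_at_crossing[of "min d s" s dQ 0])
    show "dQ (min d s) \<le> 0"
      using dQ_neg_while_Q_gt_1[of "min d s"] d_props s_pos by (simp add: less_imp_le)
    fix x assume "min d s \<le> x" "x \<le> s"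
    then have x_pos: "0 < x" using d_props s_pos by simp
    show "(dQ has_real_derivative Q x - Q x ^ 3 - 2 * dQ x / x) (at x)" using dQ_deriv[OF x_pos] .
    show "Q x - Q x ^ 3 - 2 * dQ x / x < 0" if "dQ x = 0" using ddQ_neg_if_critical[OF x_pos that] .
  qed simp
  have "dQ t \<noteq> 0"
  proof
    assume "dQ t = 0"
    then obtain e where e_props: "0 < e" "\<And>h. 0 < h \<Longrightarrow> h < e \<Longrightarrow> dQ t < dQ (t - h)"
      using DERIV_neg_dec_left[OF dQ_deriv[OF assms] ddQ_neg_if_critical[OF assms]] by blast
    define h where "h = min (e / 2) (t / 2)"
    have "0 < h" "h < e" "0 < t - h" using e_props assms by (auto simp: h_def min_def)
    then show False using e_props(2)[of h] nonpos[of "t - h"] \<open>dQ t = 0\<close> by simp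
  qed
  then show ?thesis using nonpos[OF assms] by simp
qed

lemma Q_strict_antimono: assumes "0 \<le> s" "s < t" shows "Q t < Q s"
proof (rule DERIV_neg_imp_decreasing_open[OF assms(2)])
  show "\<exists>y. (Q has_real_derivative y) (at x) \<and> y < 0" if "s < x" "x < t" for x
    using Q_deriv[of x] dQ_neg[of x] that assms by auto
  show "continuous_on {s..t} Q" using assms by (intro continuous_on_subset[OF Q_cont]) auto
qed

lemma Q_sq_antimono: assumes "0 \<le> s" "s \<le> t" shows "(Q t)\<^sup>2 \<le> (Q s)\<^sup>2"
  using Q_strict_antimono[of s t] Q_pos[of t] assms
  by (cases "s = t") (auto intro!: power_mono)

section \<open>The reduced profile\<close>

definition u where "u t = t * Q t"
definition du where "du t = Q t + t * dQ t"

lemma u_0: "u 0 = 0" and du_0: "du 0 = Q 0"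
  by (simp_all add: u_def du_def)

lemma u_pos: "0 < t \<Longrightarrow> 0 < u t"
  by (simp add: u_def Q_pos)

lemma u_deriv: "0 < t \<Longrightarrow> (u has_real_derivative du t) (at t)"
  unfolding u_def[abs_def] du_def by (auto intro!: derivative_eq_intros Q_deriv)

lemma du_deriv: assumes "0 < t" shows "(du has_real_derivative u t * (1 - (Q t)\<^sup>2)) (at t)"
proof -
  have "(du has_real_derivative dQ t + (dQ t + t * (Q t - Q t ^ 3 - 2 * dQ t / t))) (at t)"
    unfolding du_def[abs_def] using assms
    by (auto intro!: derivative_eq_intros Q_deriv dQ_deriv)
  moreover have "dQ t + (dQ t + t * (Q t - Q t ^ 3 - 2 * dQ t / t)) = u t * (1 - (Q t)\<^sup>2)"
    using assms by (simp add: u_def field_simps power2_eq_square power3_eq_cube)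
  ultimately show ?thesis by simp
qed

lemma u_cont: "continuous_on {0..} u" and du_cont: "continuous_on {0..} du"
  unfolding u_def[abs_def] du_def[abs_def] by (intro continuous_intros Q_cont dQ_cont)+

lemma du_lower_bound_nonpos:
  assumes "0 < a" "\<And>t. a \<le> t \<Longrightarrow> d \<le> du t" shows "d \<le> 0"
proof (rule ccontr)
  assume "\<not> d \<le> 0"
  then obtain T where T_props: "0 < T" "\<And>t. T \<le> t \<Longrightarrow> Q t < d / 2"
    using Q_eventually_less[of "d / 2"] by auto
  define s where "s = max T (2 * a)"
  have s_bounds: "T \<le> s" "2 * a \<le> s" by (auto simp: s_def)
  have "u a + d * (s - a) \<le> u s"
    using assms s_bounds by (intro DERIV_ge_imp_linear_lower_bound[of a s u du] u_deriv) auto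
  moreover have "u s < s * (d / 2)" using T_props s_bounds by (simp add: u_def)
  moreover have "d * (s / 2) \<le> d * (s - a)" using s_bounds \<open>\<not> d \<le> 0\<close> by (intro mult_left_mono) auto
  ultimately show False using u_pos[OF assms(1)] by (simp add: field_simps)
qed

lemma du_neg_if_Q_sq_less_1:
  assumes "0 < t" "\<And>x. t \<le> x \<Longrightarrow> (Q x)\<^sup>2 < 1" shows "du t < 0"
proof (rule ccontr)
  assume "\<not> du t < 0"
  have du_less: "du r < du s" if r_less_s: "t \<le> r" "r < s" for r s
  proof (rule DERIV_pos_imp_increasing[OF r_less_s(2)])
    fix x assume "r \<le> x" "x \<le> s"
    then have x_bounds: "0 < x" "t \<le> x" using assms r_less_s by auto
    then have "0 < u x * (1 - (Q x)\<^sup>2)" using u_pos assms(2) by (intro mult_pos_pos) auto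
    then show "\<exists>y. (du has_real_derivative y) (at x) \<and> 0 < y"
      using du_deriv[OF x_bounds(1)] by blast
  qed
  have "du (t + 1) \<le> du x" if "t + 1 \<le> x" for x
    using du_less[of "t + 1" x] that by (cases "x = t + 1") auto
  then have "du (t + 1) \<le> 0" using du_lower_bound_nonpos[of "t + 1"] assms(1) by simp
  then show False using du_less[of t "t + 1"] \<open>\<not> du t < 0\<close> by simp
qed

lemma du_eventually_neg:
  obtains T where "0 < T" "\<And>t. T \<le> t \<Longrightarrow> du t < 0"
proof -
  obtain T where T_props: "0 < T" "\<And>t. T \<le> t \<Longrightarrow> (Q t)\<^sup>2 < 1"
    using Q_sq_eventually_less[of 1] by auto
  then have "du t < 0" if "T \<le> t" for t
    using that by (intro du_neg_if_Q_sq_less_1) auto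
  then show thesis using that T_props(1) by blast
qed

text \<open>The energy of u for the autonomous equation obtained by freezing the coefficient
  \<open>1 / t^2\<close> of \<open>u^3\<close> in the equation of u; it decreases since that coefficient does.\<close>

definition frozen_energy where
  "frozen_energy t = 2 * (du t)\<^sup>2 - 2 * (u t)\<^sup>2 + (u t)\<^sup>2 * (Q t)\<^sup>2"

lemma frozen_energy_strict_antimono:
  assumes "0 < s" "s < t" shows "frozen_energy t < frozen_energy s"
proof (rule DERIV_neg_imp_decreasing[OF assms(2)])
  fix x assume "s \<le> x" "x \<le> t"
  then have x_pos: "0 < x" using assms by simp
  have dQ_eq: "dQ x = (du x - Q x) / x" using x_pos by (simp add: du_def)
  have "(frozen_energy has_real_derivative - 2 * (u x)\<^sup>2 * (Q x)\<^sup>2 / x) (at x)"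
    unfolding frozen_energy_def[abs_def] using x_pos
    by (auto intro!: derivative_eq_intros Q_deriv u_deriv du_deriv
        simp: dQ_eq u_def field_simps power2_eq_square)
  moreover have "- 2 * (u x)\<^sup>2 * (Q x)\<^sup>2 / x < 0"
    using x_pos u_pos[of x] Q_pos[of x] by (simp add: divide_neg_pos)
  ultimately show "\<exists>y. (frozen_energy has_real_derivative y) (at x) \<and> y < 0" by blast
qed

text \<open>Otherwise u would be bounded away from 0, hence \<open>u''\<close> as well, and \<open>u'\<close> would become
  positive.\<close>

lemma frozen_energy_pos: assumes "0 < t" shows "0 < frozen_energy t"
proof (rule ccontr)
  assume neg: "\<not> 0 < frozen_energy t"
  define e where "e = - frozen_energy (t + 1)"
  have e_pos: "0 < e"
    using frozen_energy_strict_antimono[of t "t + 1"] assms neg by (simp add: e_def)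
  obtain T where T_props: "0 < T" "\<And>t. T \<le> t \<Longrightarrow> du t < 0" using du_eventually_neg by blast
  obtain T' where T'_props: "\<And>t. T' \<le> t \<Longrightarrow> (Q t)\<^sup>2 < 1 / 2"
    using Q_sq_eventually_less[of "1 / 2"] by auto
  define R where "R = Max {T, T', t + 1}"
  have R_ge: "T \<le> R" "T' \<le> R" "t + 1 \<le> R" by (auto simp: R_def)
  have u_ge: "sqrt (e / 2) \<le> u s" if R_le_s: "R \<le> s" for s
  proof -
    have "frozen_energy s \<le> - e"
      using frozen_energy_strict_antimono[of "t + 1" s] R_ge R_le_s assms
      by (cases "s = t + 1") (auto simp: e_def)
    moreover have "0 \<le> (du s)\<^sup>2" "0 \<le> (u s)\<^sup>2 * (Q s)\<^sup>2" by simp_all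
    ultimately have "e / 2 \<le> (u s)\<^sup>2" unfolding frozen_energy_def by linarith
    then show ?thesis using u_pos[of s] R_le_s R_ge assms by (intro real_le_lsqrt) auto
  qed
  have ddu_ge: "sqrt (e / 2) * (1 / 2) \<le> u s * (1 - (Q s)\<^sup>2)" if R_le_s: "R \<le> s" for s
    using u_ge[OF R_le_s] u_pos[of s] T'_props[of s] R_ge R_le_s e_pos assms
    by (intro mult_mono) auto
  obtain s where "R \<le> s" "0 \<le> du s"
  proof (rule DERIV_ge_pos_imp_unbounded)
    show "0 < sqrt (e / 2) * (1 / 2)" using e_pos by simp
    show "(du has_real_derivative u s * (1 - (Q s)\<^sup>2)) (at s)" if "R \<le> s" for s
      using du_deriv[of s] that R_ge T_props by simp
  qed (rule ddu_ge)
  then show False using T_props(2)[of s] R_ge by simp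
qed

lemma u_plus_du_exp_strict_antimono:
  assumes "0 < s" "s < t" shows "(u t + du t) * exp (- t) < (u s + du s) * exp (- s)"
proof (rule DERIV_neg_imp_decreasing[OF assms(2), of "\<lambda>t. (u t + du t) * exp (- t)"])
  fix x assume "s \<le> x" "x \<le> t"
  then have x_pos: "0 < x" using assms by simp
  have "((\<lambda>t. (u t + du t) * exp (- t)) has_real_derivative - (u x * (Q x)\<^sup>2) * exp (- x)) (at x)"
    using x_pos by (auto intro!: derivative_eq_intros u_deriv du_deriv simp: algebra_simps)
  moreover have "- (u x * (Q x)\<^sup>2) * exp (- x) < 0" using x_pos u_pos[of x] Q_pos[of x] by simp
  ultimately show "\<exists>y. ((\<lambda>t. (u t + du t) * exp (- t)) has_real_derivative y) (at x) \<and> y < 0"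
    by blast
qed

lemma u_plus_du_pos: assumes "0 < t" shows "0 < u t + du t"
proof (rule ccontr)
  assume neg: "\<not> 0 < u t + du t"
  let ?m = "\<lambda>t. (u t + du t) * exp (- t)"
  define e where "e = - ?m (t + 1)"
  have "?m t \<le> 0" using neg by (intro mult_nonpos_nonneg) auto
  then have e_pos: "0 < e"
    using u_plus_du_exp_strict_antimono[of t "t + 1"] assms by (simp add: e_def)
  have du_le: "e \<le> - du s" if s_bounds: "t + 1 \<le> s" for s
  proof -
    have "?m s \<le> - e"
      using u_plus_du_exp_strict_antimono[of "t + 1" s] s_bounds assms
      by (cases "s = t + 1") (auto simp: e_def)
    then have "u s + du s \<le> - e * exp s" by (simp add: exp_minus field_simps)
    moreover have "e * 1 \<le> e * exp s" using e_pos s_bounds assms by (intro mult_left_mono) auto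
    ultimately show ?thesis using u_pos[of s] s_bounds assms by simp
  qed
  obtain s where "t + 1 \<le> s" "0 \<le> - u s"
  proof (rule DERIV_ge_pos_imp_unbounded[OF e_pos])
    show "((\<lambda>s. - u s) has_real_derivative - du s) (at s)" if "t + 1 \<le> s" for s
      using that assms by (intro DERIV_minus u_deriv) simp
  qed (rule du_le)
  then show False using u_pos[of s] assms by simp
qed

end

section \<open>Bounds for the profile near the origin\<close>

text \<open>With \<open>a = - t Q' / Q\<close> and \<open>c = t^2\<close>, the terms of low order are those of the Taylor expansion
  of \<open>u^2\<close> at the origin; the others are fitted numerically.\<close>

definition u2_upper :: "real \<Rightarrow> real \<Rightarrow> real" where
  "u2_upper a c = c + 3 * a - 9/5 * a\<^sup>2 - 2/5 * a * c + 16/125 * a ^ 3 - 9/50 * a\<^sup>2 * c + 1/20 * a ^ 5"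

definition u2_upper_da :: "real \<Rightarrow> real \<Rightarrow> real" where
  "u2_upper_da a c = 3 - 18/5 * a - 2/5 * c + 48/125 * a\<^sup>2 - 9/25 * a * c + 1/4 * a ^ 4"

definition u2_upper_dc :: "real \<Rightarrow> real" where
  "u2_upper_dc a = 1 - 2/5 * a - 9/50 * a\<^sup>2"

definition u2_lower :: "real \<Rightarrow> real \<Rightarrow> real" where
  "u2_lower a c = c + 3 * a - 9/5 * a\<^sup>2 - 7/10 * a * c + 1/10 * a ^ 3"

definition u2_lower_da :: "real \<Rightarrow> real \<Rightarrow> real" where
  "u2_lower_da a c = 3 - 18/5 * a - 7/10 * c + 3/10 * a\<^sup>2"

definition u2_lower_dc :: "real \<Rightarrow> real" where
  "u2_lower_dc a = 1 - 7/10 * a"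

lemma u2_upper_deriv:
  assumes "(f has_real_derivative f') (at t)"
  shows "((\<lambda>t. u2_upper (f t) (t\<^sup>2)) has_real_derivative
    u2_upper_da (f t) (t\<^sup>2) * f' + u2_upper_dc (f t) * (2 * t)) (at t)"
  unfolding u2_upper_def u2_upper_da_def u2_upper_dc_def
  by (rule DERIV_cong, (rule derivative_intros assms)+) (simp, algebra)

lemma u2_lower_deriv:
  assumes "(f has_real_derivative f') (at t)"
  shows "((\<lambda>t. u2_lower (f t) (t\<^sup>2)) has_real_derivative
    u2_lower_da (f t) (t\<^sup>2) * f' + u2_lower_dc (f t) * (2 * t)) (at t)"
  unfolding u2_lower_def u2_lower_da_def u2_lower_dc_def
  by (rule DERIV_cong, (rule derivative_intros assms)+) (simp, algebra)

lemma u2_upper_flow: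
  assumes "0 \<le> a" "a \<le> 1"
  shows "u2_upper a c * (2 - 2 * a)
    \<le> u2_upper_da a c * (a\<^sup>2 - a + u2_upper a c - c) + 2 * c * u2_upper_dc a"
proof -
  define A2 where "A2 = 4/25 + 27/125 * a + 81/1250 * a\<^sup>2"
  define A1 where "A1 = - 3/10 + 232/625 * a - 72/625 * a\<^sup>2 - 3/25 * a ^ 3 - 63/1000 * a ^ 4"
  define A0 where "A0 = 22/125 - 64/125 * a + 37447/62500 * a\<^sup>2 - 7/25 * a ^ 3 + 32/625 * a ^ 4"
  have "4 * A2 * A0 - A1\<^sup>2 = 283 / 12500 * (1 - a) ^ 8 + 3566 / 15625 * a * (1 - a) ^ 7
      + 290409 / 390625 * a ^ 2 * (1 - a) ^ 6 + 2256054 / 1953125 * a ^ 3 * (1 - a) ^ 5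
      + 78984203 / 78125000 * a ^ 4 * (1 - a) ^ 4 + 12357803 / 19531250 * a ^ 5 * (1 - a) ^ 3
      + 14632909 / 39062500 * a ^ 6 * (1 - a) ^ 2 + 5806781 / 39062500 * a ^ 7 * (1 - a)
      + 5650279 / 625000000 * a ^ 8"
    unfolding A2_def A1_def A0_def by algebra
  also have "\<dots> \<ge> 0" using assms by (intro add_nonneg_nonneg mult_nonneg_nonneg zero_le_power) auto
  finally have disc: "0 \<le> 4 * A2 * A0 - A1\<^sup>2" .
  have A2_pos: "0 < A2"
    using assms unfolding A2_def by (intro add_pos_nonneg mult_nonneg_nonneg) auto
  have "4 * A2 * (A2 * c\<^sup>2 + A1 * a * c + A0 * a\<^sup>2)
      = (2 * A2 * c + A1 * a)\<^sup>2 + (4 * A2 * A0 - A1\<^sup>2) * a\<^sup>2"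
    by algebra
  also have "\<dots> \<ge> 0" using disc by simp
  finally have "0 \<le> A2 * c\<^sup>2 + A1 * a * c + A0 * a\<^sup>2" using A2_pos by (simp add: zero_le_mult_iff)
  then have "0 \<le> a * (A2 * c\<^sup>2 + A1 * a * c + A0 * a\<^sup>2) + 1/80 * a ^ 9"
    using assms(1) by simp
  also have "\<dots> = u2_upper_da a c * (a\<^sup>2 - a + u2_upper a c - c) + 2 * c * u2_upper_dc a
      - u2_upper a c * (2 - 2 * a)"
    unfolding u2_upper_def u2_upper_da_def u2_upper_dc_def A2_def A1_def A0_def by algebra
  finally show ?thesis by simp
qed

lemma u2_lower_flow:
  assumes "0 \<le> a" "a \<le> 1" "0 \<le> c" "c \<le> 7/8" "c \<le> 3 * (1 - a)"
  shows "u2_lower_da a c * (a\<^sup>2 - a + u2_lower a c - c) + 2 * c * u2_lower_dc a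
    \<le> u2_lower a c * (2 - 2 * a)"
proof -
  define f where "f = - 3/2 + 49/100 * c + 42/25 * a - 7/25 * a\<^sup>2"
  define g where "g = - 1/50 - 2/5 * a + 3/100 * a\<^sup>2"
  have a_sq_le: "a\<^sup>2 \<le> a" using assms by (simp add: power2_eq_square mult_left_le)
  have f_nonpos: "f \<le> 0"
  proof (cases "a \<le> 7/10")
    case True
    have "0 \<le> (a - 7/10)\<^sup>2" by simp
    then show ?thesis using True assms by (simp add: f_def power2_eq_square algebra_simps)
  next
    case False
    then have "7/10 * a \<le> a * a" using assms by (intro mult_right_mono) auto
    then show ?thesis using assms by (simp add: f_def power2_eq_square)
  qed
  have g_nonpos: "g \<le> 0" using a_sq_le assms by (simp add: g_def)
  have "a * (c * f + a\<^sup>2 * g) \<le> 0"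
    using assms f_nonpos g_nonpos by (intro mult_nonneg_nonpos add_nonpos_nonpos) auto
  also have "a * (c * f + a\<^sup>2 * g) = u2_lower_da a c * (a\<^sup>2 - a + u2_lower a c - c)
      + 2 * c * u2_lower_dc a - u2_lower a c * (2 - 2 * a)"
    unfolding u2_lower_def u2_lower_da_def u2_lower_dc_def f_def g_def by algebra
  finally show ?thesis by simp
qed

lemma u2_lower_le_3:
  assumes "0 \<le> a" "a \<le> 1" "0 \<le> c" "c \<le> 7/8" shows "u2_lower a c \<le> 3"
proof -
  have "0 \<le> a * c" "a ^ 3 \<le> 1" using assms by (auto simp: power_le_one)
  moreover have "0 \<le> (a - 5/6)\<^sup>2" by simp
  then have "3 * a - 9/5 * a\<^sup>2 \<le> 5/4" by (simp add: power2_eq_square algebra_simps)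
  ultimately show ?thesis unfolding u2_lower_def using assms by linarith
qed

context ground_state begin

definition rho where "rho t = - (t * dQ t / Q t)"

lemma rho_0: "rho 0 = 0"
  by (simp add: rho_def)

lemma rho_cont: "continuous_on {0..} rho"
  unfolding rho_def[abs_def] using Q_pos by (intro continuous_intros Q_cont dQ_cont) force

lemma rho_pos: "0 < t \<Longrightarrow> 0 < rho t"
  using dQ_neg[of t] Q_pos[of t] by (simp add: rho_def mult_pos_neg divide_neg_pos)

lemma du_eq: "0 < t \<Longrightarrow> du t = u t * (1 - rho t) / t"
  using Q_pos[of t] by (simp add: du_def u_def rho_def field_simps)

lemma rho_deriv:
  assumes "0 < t"
  shows "(rho has_real_derivative ((rho t)\<^sup>2 - rho t + (u t)\<^sup>2 - t\<^sup>2) / t) (at t)"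
proof -
  have "(rho has_real_derivative
      - (((1 * dQ t + t * (Q t - Q t ^ 3 - 2 * dQ t / t)) * Q t - t * dQ t * dQ t) / (Q t * Q t))) (at t)"
    unfolding rho_def[abs_def] using assms Q_pos[of t]
    by (auto intro!: derivative_eq_intros Q_deriv dQ_deriv)
  moreover have "- (((1 * dQ t + t * (Q t - Q t ^ 3 - 2 * dQ t / t)) * Q t - t * dQ t * dQ t) / (Q t * Q t))
      = ((rho t)\<^sup>2 - rho t + (u t)\<^sup>2 - t\<^sup>2) / t"
    using assms Q_pos[of t]
    by (simp add: rho_def u_def field_simps power2_eq_square power3_eq_cube)
  ultimately show ?thesis by simp
qed

lemma u_sq_deriv:
  assumes "0 < t"
  shows "((\<lambda>t. (u t)\<^sup>2) has_real_derivative 2 * (u t)\<^sup>2 * (1 - rho t) / t) (at t)"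
  using assms by (auto intro!: derivative_eq_intros u_deriv simp: du_eq power2_eq_square)

text \<open>The sign \<open>\<sigma>\<close> decides between upper bounds (1) and lower bounds (-1) for \<open>u^2\<close>.\<close>

lemma u_sq_barrier:
  fixes \<beta> \<beta>a :: "real \<Rightarrow> real \<Rightarrow> real" and \<beta>c :: "real \<Rightarrow> real" and \<sigma> :: real
  assumes cont: "continuous_on {0..T} (\<lambda>t. \<beta> (rho t) (t\<^sup>2))" "continuous_on {0..T} (\<lambda>t. \<beta>a (rho t) (t\<^sup>2))"
    and init: "\<beta> 0 0 = 0" "2 < \<beta>a 0 0"
    and deriv: "\<And>t f'. (rho has_real_derivative f') (at t) \<Longrightarrow>
      ((\<lambda>t. \<beta> (rho t) (t\<^sup>2)) has_real_derivative \<beta>a (rho t) (t\<^sup>2) * f' + \<beta>c (rho t) * (2 * t)) (at t)"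
    and flow: "\<And>t. 0 < t \<Longrightarrow> t \<le> T \<Longrightarrow> 0 < \<sigma> * ((u t)\<^sup>2 - \<beta> (rho t) (t\<^sup>2)) \<Longrightarrow>
      \<sigma> * (\<beta> (rho t) (t\<^sup>2) * (2 - 2 * rho t))
      \<le> \<sigma> * (\<beta>a (rho t) (t\<^sup>2) * ((rho t)\<^sup>2 - rho t + \<beta> (rho t) (t\<^sup>2) - t\<^sup>2) + 2 * t\<^sup>2 * \<beta>c (rho t))"
    and t_bounds: "0 < t" "t \<le> T"
  shows "\<sigma> * ((u t)\<^sup>2 - \<beta> (rho t) (t\<^sup>2)) \<le> 0"
proof -
  let ?f = "\<lambda>t. \<sigma> * ((u t)\<^sup>2 - \<beta> (rho t) (t\<^sup>2))"
  let ?f' = "\<lambda>t. \<sigma> * (2 * (u t)\<^sup>2 * (1 - rho t) / t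
    - (\<beta>a (rho t) (t\<^sup>2) * (((rho t)\<^sup>2 - rho t + (u t)\<^sup>2 - t\<^sup>2) / t) + \<beta>c (rho t) * (2 * t)))"
  let ?g = "\<lambda>t. 2 - 2 * rho t - \<beta>a (rho t) (t\<^sup>2)"
  have rho_u: "continuous_on {0..T} rho" "continuous_on {0..T} u"
    by (auto intro!: continuous_on_subset[OF rho_cont] continuous_on_subset[OF u_cont])
  show ?thesis
  proof (rule nonpos_if_singular_differential_inequality[of T ?f ?g ?f'])
    show "continuous_on {0..T} ?f" "continuous_on {0..T} ?g"
      by (intro continuous_intros cont rho_u)+
    show "?f 0 \<le> 0" "?g 0 < 0" using init by (simp_all add: rho_0 u_0)
    fix x assume x_bounds: "0 < x" "x \<le> T"
    show "(?f has_real_derivative ?f' x) (at x)"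
      using x_bounds by (intro DERIV_cmult DERIV_diff u_sq_deriv deriv rho_deriv)
    assume "0 < ?f x"
    note flow[OF x_bounds this]
    moreover have "x * ?f' x = ?g x * ?f x + (\<sigma> * (\<beta> (rho x) (x\<^sup>2) * (2 - 2 * rho x))
        - \<sigma> * (\<beta>a (rho x) (x\<^sup>2) * ((rho x)\<^sup>2 - rho x + \<beta> (rho x) (x\<^sup>2) - x\<^sup>2) + 2 * x\<^sup>2 * \<beta>c (rho x)))"
      using x_bounds by (simp add: field_simps power2_eq_square)
    ultimately show "x * ?f' x \<le> ?g x * ?f x" by linarith
  qed (use t_bounds in auto)
qed

definition tmax where
  "tmax = (SOME s. 0 < s \<and> du s = 0 \<and> (\<forall>t. 0 \<le> t \<and> t < s \<longrightarrow> 0 < du t))"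

lemma
  shows tmax_pos: "0 < tmax" and du_tmax: "du tmax = 0"
    and du_pos_before_tmax: "\<And>t. 0 \<le> t \<Longrightarrow> t < tmax \<Longrightarrow> 0 < du t"
proof -
  obtain T where T_props: "0 < T" "\<And>t. T \<le> t \<Longrightarrow> du t < 0" using du_eventually_neg by blast
  have "continuous_on {0..T} du" by (rule continuous_on_subset[OF du_cont]) auto
  then obtain s where "0 < s" "du s = 0" "\<And>t. 0 \<le> t \<Longrightarrow> t < s \<Longrightarrow> 0 < du t"
    using first_zero[of 0 T du] T_props(1) T_props(2)[of T] Q_pos[of 0] du_0
    by (auto simp: less_imp_le)
  then have "\<exists>s. 0 < s \<and> du s = 0 \<and> (\<forall>t. 0 \<le> t \<and> t < s \<longrightarrow> 0 < du t)" by blast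
  from someI_ex[OF this]
  show "0 < tmax" "du tmax = 0" "\<And>t. 0 \<le> t \<Longrightarrow> t < tmax \<Longrightarrow> 0 < du t"
    by (auto simp: tmax_def)
qed

lemma u_sq_gt_before_tmax: assumes "0 < t" "t \<le> tmax" shows "2 * t\<^sup>2 < (u t)\<^sup>2"
proof -
  have "0 < (u tmax)\<^sup>2 * ((Q tmax)\<^sup>2 - 2)"
    using frozen_energy_pos[of tmax] tmax_pos du_tmax by (simp add: frozen_energy_def algebra_simps)
  then have "2 < (Q tmax)\<^sup>2" by (simp add: zero_less_mult_iff)
  then have "2 < (Q t)\<^sup>2" using Q_sq_antimono[of t tmax] assms by simp
  then have "t\<^sup>2 * 2 < t\<^sup>2 * (Q t)\<^sup>2" using assms by (intro mult_strict_left_mono) auto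
  then show ?thesis by (simp add: u_def power_mult_distrib)
qed

lemma rho_tmax: "rho tmax = 1"
  using du_eq[of tmax] tmax_pos du_tmax u_pos[of tmax] by simp

lemma rho_le_1: assumes "0 < t" "t \<le> tmax" shows "rho t \<le> 1"
proof (cases "t = tmax")
  case False
  then have "0 < u t * (1 - rho t) / t" using du_pos_before_tmax[of t] assms du_eq[of t] by simp
  then show ?thesis using u_pos[of t] assms by (simp add: zero_less_divide_iff zero_less_mult_iff)
qed (simp add: rho_tmax)

lemma u_sq_le_upper:
  assumes "0 < t" "t \<le> tmax" shows "(u t)\<^sup>2 \<le> u2_upper (rho t) (t\<^sup>2)"
proof -
  have "1 * ((u t)\<^sup>2 - u2_upper (rho t) (t\<^sup>2)) \<le> 0"
  proof (rule u_sq_barrier[OF _ _ _ _ u2_upper_deriv])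
    have cont: "continuous_on {0..tmax} rho" by (rule continuous_on_subset[OF rho_cont]) auto
    show "continuous_on {0..tmax} (\<lambda>t. u2_upper (rho t) (t\<^sup>2))"
        "continuous_on {0..tmax} (\<lambda>t. u2_upper_da (rho t) (t\<^sup>2))"
      unfolding u2_upper_def u2_upper_da_def by (intro continuous_intros cont)+
    show "u2_upper 0 0 = 0" "2 < u2_upper_da 0 0" by (simp_all add: u2_upper_def u2_upper_da_def)
    fix x assume "0 < x" "x \<le> tmax"
    then show "1 * (u2_upper (rho x) (x\<^sup>2) * (2 - 2 * rho x)) \<le> 1 * (u2_upper_da (rho x) (x\<^sup>2)
        * ((rho x)\<^sup>2 - rho x + u2_upper (rho x) (x\<^sup>2) - x\<^sup>2) + 2 * x\<^sup>2 * u2_upper_dc (rho x))"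
      using u2_upper_flow[of "rho x" "x\<^sup>2"] rho_pos[of x] rho_le_1[of x] by simp
  qed (use assms in auto)
  then show ?thesis by simp
qed

lemma u_sq_tmax_le: "(u tmax)\<^sup>2 \<le> 689/500 + 21/50 * tmax\<^sup>2"
  using u_sq_le_upper[of tmax] tmax_pos by (simp add: rho_tmax u2_upper_def)

lemma tmax_sq_less: "tmax\<^sup>2 < 7/8"
  using u_sq_tmax_le u_sq_gt_before_tmax[of tmax] tmax_pos by simp

lemma t_sq_less_before_tmax: assumes "0 < t" "t \<le> tmax" shows "t\<^sup>2 < 7/8"
proof -
  have "t\<^sup>2 \<le> tmax\<^sup>2" using assms by (intro power_mono) auto
  then show ?thesis using tmax_sq_less by simp
qed

end

section \<open>A supersolution near the origin\<close>

context ground_state begin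

text \<open>The product \<open>u t * inner_factor t\<close> is a strict supersolution of the linear equation as long as
  it is positive. In the scaling limit of large \<^term>\<open>Q 0\<close> the linear equation is solved by
  \<^term>\<open>t * du t = u t * (1 - rho t)\<close>; the other terms account for the mass term.\<close>

definition inner_factor where
  "inner_factor t = 1 - rho t - t\<^sup>2 / 2 + 3/100 * t\<^sup>2 * (u t)\<^sup>2 + t ^ 4 / 30"

lemma inner_factor_tmax: "inner_factor tmax < 0"
proof -
  have "inner_factor tmax = tmax\<^sup>2 * (- 1/2 + 3/100 * (u tmax)\<^sup>2 + tmax\<^sup>2 / 30)"
    by (simp add: inner_factor_def rho_tmax algebra_simps flip: power_add)
  moreover have "- 1/2 + 3/100 * (u tmax)\<^sup>2 + tmax\<^sup>2 / 30 < 0"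
    using u_sq_tmax_le tmax_sq_less by simp
  ultimately show ?thesis using tmax_pos by (simp add: mult_pos_neg)
qed

definition tau where
  "tau = (SOME s. 0 < s \<and> s < tmax \<and> inner_factor s = 0 \<and> (\<forall>t. 0 \<le> t \<and> t < s \<longrightarrow> 0 < inner_factor t))"

lemma
  shows tau_pos: "0 < tau" and tau_less_tmax: "tau < tmax"
    and inner_factor_tau: "inner_factor tau = 0"
    and inner_factor_pos: "\<And>t. 0 \<le> t \<Longrightarrow> t < tau \<Longrightarrow> 0 < inner_factor t"
proof -
  have "continuous_on {0..tmax} inner_factor"
    unfolding inner_factor_def[abs_def]
    by (intro continuous_intros continuous_on_subset[OF rho_cont] continuous_on_subset[OF u_cont]) auto
  then obtain s where s_props: "0 < s" "s \<le> tmax" "inner_factor s = 0"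
      "\<And>t. 0 \<le> t \<Longrightarrow> t < s \<Longrightarrow> 0 < inner_factor t"
    using first_zero[of 0 tmax inner_factor] tmax_pos inner_factor_tmax
    by (auto simp: inner_factor_def rho_0 less_imp_le)
  then have "s < tmax" using inner_factor_tmax by (cases "s = tmax") auto
  then have "\<exists>s. 0 < s \<and> s < tmax \<and> inner_factor s = 0 \<and> (\<forall>t. 0 \<le> t \<and> t < s \<longrightarrow> 0 < inner_factor t)"
    using s_props by blast
  from someI_ex[OF this]
  show "0 < tau" "tau < tmax" "inner_factor tau = 0" "\<And>t. 0 \<le> t \<Longrightarrow> t < tau \<Longrightarrow> 0 < inner_factor t"
    by (auto simp: tau_def)
qed

lemma u_sq_ge_lower:
  assumes "0 < t" "t \<le> tau" shows "u2_lower (rho t) (t\<^sup>2) \<le> (u t)\<^sup>2"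
proof -
  have "- 1 * ((u t)\<^sup>2 - u2_lower (rho t) (t\<^sup>2)) \<le> 0"
  proof (rule u_sq_barrier[OF _ _ _ _ u2_lower_deriv])
    have cont: "continuous_on {0..tau} rho" by (rule continuous_on_subset[OF rho_cont]) auto
    show "continuous_on {0..tau} (\<lambda>t. u2_lower (rho t) (t\<^sup>2))"
        "continuous_on {0..tau} (\<lambda>t. u2_lower_da (rho t) (t\<^sup>2))"
      unfolding u2_lower_def u2_lower_da_def by (intro continuous_intros cont)+
    show "u2_lower 0 0 = 0" "2 < u2_lower_da 0 0" by (simp_all add: u2_lower_def u2_lower_da_def)
    fix x assume x_bounds: "0 < x" "x \<le> tau"
      and less: "0 < - 1 * ((u x)\<^sup>2 - u2_lower (rho x) (x\<^sup>2))"
    have a_bounds: "0 \<le> rho x" "rho x \<le> 1" and c_bounds: "0 \<le> x\<^sup>2" "x\<^sup>2 \<le> 7/8"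
      using rho_pos[of x] rho_le_1[of x] t_sq_less_before_tmax[of x] x_bounds tau_less_tmax by auto
    have "(u x)\<^sup>2 < 3" using u2_lower_le_3[OF a_bounds c_bounds] less by simp
    then have "x\<^sup>2 * (1/3) \<le> x\<^sup>2 * (1/2 - 3/100 * (u x)\<^sup>2 - x\<^sup>2 / 30)"
      using c_bounds by (intro mult_left_mono) auto
    also have "\<dots> = 1 - rho x - inner_factor x"
      by (simp add: inner_factor_def algebra_simps power2_eq_square power4_eq_xxxx)
    also have "\<dots> \<le> 1 - rho x"
      using inner_factor_tau inner_factor_pos[of x] x_bounds by (cases "x = tau") auto
    finally have "x\<^sup>2 \<le> 3 * (1 - rho x)" by simp
    then show "- 1 * (u2_lower (rho x) (x\<^sup>2) * (2 - 2 * rho x)) \<le> - 1 * (u2_lower_da (rho x) (x\<^sup>2)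
        * ((rho x)\<^sup>2 - rho x + u2_lower (rho x) (x\<^sup>2) - x\<^sup>2) + 2 * x\<^sup>2 * u2_lower_dc (rho x))"
      using u2_lower_flow[OF a_bounds c_bounds] by simp
  qed (use assms in auto)
  then show ?thesis by simp
qed

end

definition inner_defect :: "real \<Rightarrow> real \<Rightarrow> real \<Rightarrow> real" where
  "inner_defect a b c = a - c / 2 - b + 3/100 * b * (20 - 24 * a + 6 * a\<^sup>2 + 3 * c)
    + c / 30 * (20 - 8 * a + c + 2 * b)"

lemma inner_defect_neg:
  assumes a_bounds: "0 < a" "a \<le> 1" and c_bounds: "0 \<le> c" "c \<le> 7/8" and b_ge: "u2_lower a c \<le> b"
  shows "inner_defect a b c < 0"
proof -
  define f where "f = 2/5 + 18/25 * a - 9/50 * a\<^sup>2 - 47/300 * c"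
  define q where "q = 1/5 + 36/25 * a - 449/250 * a\<^sup>2 + 99/250 * a ^ 3 - 9/500 * a ^ 4"
  define r where "r = 7/30 + 71/300 * a - 201/500 * a\<^sup>2 + 331/3000 * a ^ 3"
  have a_sq_le: "a\<^sup>2 \<le> a" using a_bounds by (simp add: power2_eq_square mult_left_le)
  then have "0 < f" using a_bounds c_bounds unfolding f_def by linarith
  then have "f * u2_lower a c \<le> f * b" using b_ge by simp
  moreover have "inner_defect a b c = - (f * b) + c * (1/6 - 4/15 * a + c / 30) + a"
    unfolding inner_defect_def f_def by algebra
  moreover have "f * u2_lower a c - c * (1/6 - 4/15 * a + c / 30) - a
      = a * q + c * (r - c * (19/100 - 329/3000 * a))"
    unfolding f_def q_def r_def u2_lower_def by algebra
  moreover have "0 < a * q"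
  proof -
    have "q = 1/5 * (1 - a) ^ 4 + 56/25 * a * (1 - a) ^ 3 + 931/250 * a\<^sup>2 * (1 - a)\<^sup>2
        + 481/250 * a ^ 3 * (1 - a) + 111/500 * a ^ 4"
      unfolding q_def by algebra
    also have "\<dots> > 0"
      using a_bounds by (intro add_nonneg_pos add_nonneg_nonneg mult_nonneg_nonneg) auto
    finally show ?thesis using a_bounds by simp
  qed
  moreover have "0 \<le> c * (r - c * (19/100 - 329/3000 * a))"
  proof -
    have "c * (19/100 - 329/3000 * a) \<le> 7/8 * (19/100 - 329/3000 * a)"
      using c_bounds a_bounds by (intro mult_right_mono) auto
    moreover have "0 \<le> a * (a - 1)\<^sup>2" using a_bounds by simp
    then have "2 * a\<^sup>2 - a \<le> a ^ 3" by (simp add: power2_eq_square power3_eq_cube algebra_simps)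
    ultimately have "c * (19/100 - 329/3000 * a) \<le> r"
      using a_bounds a_sq_le unfolding r_def by (simp add: field_simps)
    then show ?thesis using c_bounds by simp
  qed
  ultimately show ?thesis by linarith
qed

context ground_state begin

definition inner_sup where
  "inner_sup t = t * du t - 1/2 * t\<^sup>2 * u t + 3/100 * t\<^sup>2 * u t ^ 3 + 1/30 * t ^ 4 * u t"

definition dinner_sup where
  "dinner_sup t = du t + t * (u t * (1 - (Q t)\<^sup>2)) - t * u t - 1/2 * t\<^sup>2 * du t
    + 3/50 * t * u t ^ 3 + 9/100 * t\<^sup>2 * (u t)\<^sup>2 * du t + 2/15 * t ^ 3 * u t + 1/30 * t ^ 4 * du t"

definition ddinner_sup where
  "ddinner_sup t = - 3 * (Q t)\<^sup>2 * inner_sup t + u t * inner_defect (rho t) ((u t)\<^sup>2) (t\<^sup>2)"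

lemma inner_sup_eq: "0 < t \<Longrightarrow> inner_sup t = u t * inner_factor t"
  by (simp add: inner_sup_def inner_factor_def du_eq field_simps power3_eq_cube power2_eq_square)

lemma inner_sup_deriv: assumes "0 < t" shows "(inner_sup has_real_derivative dinner_sup t) (at t)"
  unfolding inner_sup_def[abs_def] dinner_sup_def
  by (rule DERIV_cong, (rule derivative_intros u_deriv[OF assms] du_deriv[OF assms])+) (simp_all, algebra)

lemma dinner_sup_deriv:
  assumes "0 < t" shows "(dinner_sup has_real_derivative ddinner_sup t) (at t)"
proof -
  let ?ddu = "u t * (1 - (Q t)\<^sup>2)"
  let ?dd = "?ddu + (?ddu + t * (du t * (1 - (Q t)\<^sup>2) - u t * (2 * Q t * dQ t)))
     - (u t + t * du t) - (t * du t + t\<^sup>2 * ?ddu / 2) + 3/50 * (u t ^ 3 + 3 * t * (u t)\<^sup>2 * du t)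
     + 9/100 * (2 * t * (u t)\<^sup>2 * du t + 2 * t\<^sup>2 * u t * (du t)\<^sup>2 + t\<^sup>2 * (u t)\<^sup>2 * ?ddu)
     + 2/15 * (3 * t\<^sup>2 * u t + t ^ 3 * du t) + (4 * t ^ 3 * du t + t ^ 4 * ?ddu) / 30"
  have "(dinner_sup has_real_derivative ?dd) (at t)"
    unfolding dinner_sup_def[abs_def]
    by (rule DERIV_cong, (rule derivative_intros u_deriv[OF assms] du_deriv[OF assms] Q_deriv[OF assms])+)
      (simp_all, algebra)
  moreover have "u t = t * Q t" "du t = Q t * (1 - rho t)" "t * dQ t = - (Q t * rho t)"
    using assms Q_pos[of t] by (auto simp: u_def du_def rho_def field_simps)
  then have "?dd = ddinner_sup t"
    unfolding ddinner_sup_def inner_sup_eq[OF assms] inner_factor_def inner_defect_def by algebra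
  ultimately show ?thesis by simp
qed

lemma tau_le_first_zero:
  assumes ode: "solves_lin_ode Q F dF" and init: "F 0 = 0" "dF 0 = - 1"
    and s_bounds: "0 < s" "F s = 0" "\<And>t. 0 < t \<Longrightarrow> t < s \<Longrightarrow> F t \<noteq> 0"
  shows "tau \<le> s"
proof (rule first_zero_ge_if_strict_supersolution[OF solves_lin_ode_uminus[OF ode]])
  show "continuous_on {0..} inner_sup" "continuous_on {0..} dinner_sup"
    unfolding inner_sup_def[abs_def] dinner_sup_def[abs_def]
    by (intro continuous_intros u_cont du_cont Q_cont)+
  show "inner_sup 0 = 0" by (simp add: inner_sup_def)
  fix t assume t_bounds: "0 < t" "t < tau"
  show "0 < inner_sup t"
    using t_bounds inner_factor_pos[of t] u_pos[of t] by (simp add: inner_sup_eq)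
  have "inner_defect (rho t) ((u t)\<^sup>2) (t\<^sup>2) < 0"
    using rho_pos[of t] rho_le_1[of t] t_sq_less_before_tmax[of t] u_sq_ge_lower[of t] t_bounds
      tau_less_tmax
    by (intro inner_defect_neg) auto
  then have "u t * inner_defect (rho t) ((u t)\<^sup>2) (t\<^sup>2) < 0"
    using u_pos[OF t_bounds(1)] by (intro mult_pos_neg)
  then show "ddinner_sup t + 3 * (Q t)\<^sup>2 * inner_sup t < 0" by (simp add: ddinner_sup_def)
qed (use init s_bounds inner_sup_deriv dinner_sup_deriv in auto)

end

section \<open>Barriers near infinity\<close>

definition K_barrier :: "real \<Rightarrow> real \<Rightarrow> real \<Rightarrow> real \<Rightarrow> real \<Rightarrow> real" where
  "K_barrier g A B t x = 2 * x / (g * t + A - B * x)"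

text \<open>Up to a positive factor, the defect of \<open>K_barrier\<close> as a solution of the differential
  equation that K satisfies along zeta.\<close>

definition barrier_defect :: "real \<Rightarrow> real \<Rightarrow> real \<Rightarrow> real \<Rightarrow> real \<Rightarrow> real" where
  "barrier_defect g A B t x = - g * t * (g * t + A - B * x)
     - t * ((2 - x) * (g * t + A - B * x) + 2) * (g * t + A)
     - 2 * (1 - x) * t * (g * t + A - B * x)\<^sup>2 + 2 * (2 - x) * (g * t + A - B * x) ^ 3
     + 2 * (g * t + A - B * x)\<^sup>2"

context ground_state begin

definition zeta where "zeta t = 1 + du t / u t"
definition K where "K t = frozen_energy t / (u t)\<^sup>2"

lemma zeta_pos: assumes "0 < t" shows "0 < zeta t"
proof -
  have "zeta t = (u t + du t) / u t"
    using u_pos[OF assms] by (simp add: zeta_def add_divide_distrib)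
  then show ?thesis using u_pos[OF assms] u_plus_du_pos[OF assms] by simp
qed

lemma K_pos: "0 < t \<Longrightarrow> 0 < K t"
  using frozen_energy_pos[of t] u_pos[of t] by (simp add: K_def)

lemma Q_sq_eq: assumes "0 < t" shows "(Q t)\<^sup>2 = 2 * zeta t * (2 - zeta t) + K t"
  using u_pos[OF assms] by (simp add: K_def frozen_energy_def zeta_def field_simps power2_eq_square)

lemma rho_eq: assumes "0 < t" shows "rho t = 1 + t * (1 - zeta t)"
  using du_eq[OF assms] u_pos[OF assms] assms by (simp add: zeta_def field_simps)

lemma zeta_deriv:
  assumes "0 < t" shows "(zeta has_real_derivative - (zeta t * (2 - zeta t) + K t)) (at t)"
proof -
  have "(zeta has_real_derivative (u t * (1 - (Q t)\<^sup>2) * u t - du t * du t) / (u t * u t)) (at t)"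
    unfolding zeta_def[abs_def] using u_pos[OF assms] u_deriv[OF assms] du_deriv[OF assms]
    by (auto intro!: derivative_eq_intros)
  moreover have "(u t * (1 - (Q t)\<^sup>2) * u t - du t * du t) / (u t * u t)
      = - (zeta t * (2 - zeta t) + K t)"
    unfolding Q_sq_eq[OF assms] using u_pos[OF assms]
    by (simp add: zeta_def field_simps power2_eq_square)
  ultimately show ?thesis by simp
qed

lemma Q_sq_deriv:
  assumes "0 < t"
  shows "((\<lambda>t. (Q t)\<^sup>2) has_real_derivative 2 * (Q t)\<^sup>2 * (zeta t - 1 - 1 / t)) (at t)"
proof -
  have "dQ t = Q t * (zeta t - 1 - 1 / t)"
    using Q_pos[of t] assms by (simp add: zeta_def du_def u_def field_simps)
  then show ?thesis using Q_deriv[OF assms]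
    by (auto intro!: derivative_eq_intros simp: power2_eq_square)
qed

lemma K_deriv:
  assumes "0 < t"
  shows "(K has_real_derivative
    2 * (1 - zeta t) * K t - 2 * (2 * zeta t * (2 - zeta t) + K t) / t) (at t)"
proof -
  let ?K = "\<lambda>t. (Q t)\<^sup>2 - 2 * zeta t * (2 - zeta t)"
  have "(?K has_real_derivative 2 * (Q t)\<^sup>2 * (zeta t - 1 - 1 / t)
      - (2 * (- (zeta t * (2 - zeta t) + K t)) * (2 - zeta t) + 2 * zeta t * (zeta t * (2 - zeta t) + K t))) (at t)"
    by (rule DERIV_cong, (rule Q_sq_deriv[OF assms] zeta_deriv[OF assms] derivative_intros)+)
      (simp add: algebra_simps)
  moreover have "2 * (Q t)\<^sup>2 * (zeta t - 1 - 1 / t)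
      - (2 * (- (zeta t * (2 - zeta t) + K t)) * (2 - zeta t) + 2 * zeta t * (zeta t * (2 - zeta t) + K t))
    = 2 * (1 - zeta t) * K t - 2 * (2 * zeta t * (2 - zeta t) + K t) / t"
    unfolding Q_sq_eq[OF assms] using assms by (simp add: field_simps power2_eq_square)
  ultimately have "(?K has_real_derivative
      2 * (1 - zeta t) * K t - 2 * (2 * zeta t * (2 - zeta t) + K t) / t) (at t)" by simp
  then show ?thesis
    by (rule has_field_derivative_transform_within_open[of _ _ _ "{0<..}"]) (use assms Q_sq_eq in auto)
qed

definition kappa where "kappa = (zeta tau - 1) / tau"

lemma zeta_tau: "zeta tau = 1 + kappa * tau"
  using tau_pos by (simp add: kappa_def)

lemma rho_tau: "rho tau = 1 - kappa * tau\<^sup>2"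
  using rho_eq[OF tau_pos] by (simp add: zeta_tau power2_eq_square algebra_simps)

lemma kappa_eq: "kappa = 1/2 - 3/100 * (u tau)\<^sup>2 - tau\<^sup>2 / 30"
proof -
  have "tau\<^sup>2 * kappa = tau\<^sup>2 * (1/2 - 3/100 * (u tau)\<^sup>2 - tau\<^sup>2 / 30)"
    using inner_factor_tau by (simp add: inner_factor_def rho_tau algebra_simps flip: power_add)
  then show ?thesis using tau_pos by simp
qed

lemma tau_sq_less: "tau\<^sup>2 < 7/8"
  using t_sq_less_before_tmax[of tau] tau_pos tau_less_tmax by simp

lemma tau_less_1: "tau < 1"
  using tau_sq_less tau_pos by (intro power2_less_imp_less[of tau 1]) auto

lemma u_tau_sq_less_2: "(u tau)\<^sup>2 < 2"
proof -
  have "u tau < u tmax"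
  proof (rule DERIV_pos_imp_increasing_open[OF tau_less_tmax])
    show "\<exists>y. (u has_real_derivative y) (at x) \<and> 0 < y" if "tau < x" "x < tmax" for x
      using u_deriv[of x] du_pos_before_tmax[of x] that tau_pos by auto
    show "continuous_on {tau..tmax} u"
      by (rule continuous_on_subset[OF u_cont]) (use tau_pos in auto)
  qed
  then have "(u tau)\<^sup>2 < (u tmax)\<^sup>2" using u_pos[OF tau_pos] by (intro power_strict_mono) auto
  then show ?thesis using u_sq_tmax_le tmax_sq_less by simp
qed

lemma kappa_bounds: "41/100 \<le> kappa" "kappa < 1/2"
proof -
  show "41/100 \<le> kappa" using u_tau_sq_less_2 tau_sq_less by (simp add: kappa_eq)
  have "0 < (u tau)\<^sup>2" "0 < tau\<^sup>2" using u_pos[OF tau_pos] tau_pos by auto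
  then show "kappa < 1/2" unfolding kappa_eq by linarith
qed

lemma zeta_tau_less: "zeta tau < 3/2"
  using mult_strict_mono[of kappa "1/2" tau 1] kappa_bounds tau_less_1 tau_pos
  by (simp add: zeta_tau)

lemma zeta_le_zeta_tau: assumes "tau \<le> t" shows "zeta t \<le> zeta tau"
proof (rule le_if_decreasing_at_crossing[OF assms order_refl])
  fix x assume "tau \<le> x" "x \<le> t"
  then have x_pos: "0 < x" using tau_pos by simp
  show "(zeta has_real_derivative - (zeta x * (2 - zeta x) + K x)) (at x)"
    using zeta_deriv[OF x_pos] .
  assume "zeta x = zeta tau"
  then have "0 < zeta x * (2 - zeta x)" using zeta_tau_less zeta_pos[OF x_pos] by simp
  then show "- (zeta x * (2 - zeta x) + K x) < 0" using K_pos[OF x_pos] by simp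
qed

lemma zeta_less: "tau \<le> t \<Longrightarrow> zeta t < 3/2"
  using zeta_le_zeta_tau[of t] zeta_tau_less by simp

lemma zeta_eventually_small: obtains T where "0 < T" "\<And>t. T \<le> t \<Longrightarrow> zeta t \<le> 1/8"
proof -
  obtain T where T_props: "0 < T" "\<And>t. T \<le> t \<Longrightarrow> (Q t)\<^sup>2 < 1/8"
    using Q_sq_eventually_less[of "1/8"] by auto
  have "zeta t \<le> 1/8" if "max T 1 \<le> t" for t
  proof -
    have t_bounds: "0 < t" "tau \<le> t" "T \<le> t" using that tau_less_1 by auto
    have "zeta t * (1/2) \<le> zeta t * (2 - zeta t)"
      using zeta_pos[OF t_bounds(1)] zeta_less[OF t_bounds(2)] by (intro mult_left_mono) auto
    then show ?thesis
      using Q_sq_eq[OF t_bounds(1)] T_props(2)[OF t_bounds(3)] K_pos[OF t_bounds(1)] by linarith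
  qed
  then show thesis using that[of "max T 1"] T_props(1) by auto
qed

definition barrier_rate where
  "barrier_rate g A B t = 2 * (1 - zeta t) - 2 / t + 2 * (g * t + A) / (g * t + A - B * zeta t)\<^sup>2"

lemma K_minus_barrier_deriv:
  assumes t_pos: "0 < t" and denom_nonzero: "g * t + A - B * zeta t \<noteq> 0"
  shows "((\<lambda>t. K t - K_barrier g A B t (zeta t)) has_real_derivative
    barrier_rate g A B t * (K t - K_barrier g A B t (zeta t))
    - 2 * zeta t / (t * (g * t + A - B * zeta t) ^ 3) * barrier_defect g A B t (zeta t)) (at t)"
proof -
  define s where "s = g * t + A - B * zeta t"
  have s_nonzero: "s \<noteq> 0" and s_eq: "g * t + A = s + B * zeta t"
    using denom_nonzero by (auto simp: s_def)
  let ?z' = "- (zeta t * (2 - zeta t) + K t)"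
  have "((\<lambda>t. K t - K_barrier g A B t (zeta t)) has_real_derivative
      2 * (1 - zeta t) * K t - 2 * (2 * zeta t * (2 - zeta t) + K t) / t
      - (2 * ?z' * s - 2 * zeta t * (g - B * ?z')) / (s * s)) (at t)"
    unfolding s_def K_barrier_def
    by (rule DERIV_cong, (rule derivative_intros K_deriv[OF t_pos] zeta_deriv[OF t_pos] denom_nonzero)+)
      (simp add: mult.commute)
  moreover have "2 * (1 - zeta t) * K t - 2 * (2 * zeta t * (2 - zeta t) + K t) / t
      - (2 * ?z' * s - 2 * zeta t * (g - B * ?z')) / (s * s)
    = (2 * (1 - zeta t) - 2 / t + 2 * (s + B * zeta t) / s\<^sup>2) * (K t - 2 * zeta t / s)
    - 2 * zeta t / (t * s ^ 3) * (- g * t * s - t * ((2 - zeta t) * s + 2) * (s + B * zeta t)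
     - 2 * (1 - zeta t) * t * s\<^sup>2 + 2 * (2 - zeta t) * s ^ 3 + 2 * s\<^sup>2)"
    using s_nonzero t_pos by (simp add: field_simps power2_eq_square power3_eq_cube)
  ultimately show ?thesis
    unfolding K_barrier_def barrier_rate_def barrier_defect_def s_def[symmetric] s_eq by simp
qed

lemma barrier_rate_ge:
  assumes "tau \<le> t" "0 \<le> g" "0 \<le> A" shows "- (1 + 2 / tau) \<le> barrier_rate g A B t"
proof -
  have t_pos: "0 < t" using tau_pos assms by simp
  have "2 / t \<le> 2 / tau" using assms tau_pos by (intro divide_left_mono) auto
  moreover have "0 \<le> 2 * (g * t + A) / (g * t + A - B * zeta t)\<^sup>2" using assms t_pos by simp
  ultimately show ?thesis unfolding barrier_rate_def using zeta_less[OF assms(1)] by argo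
qed

lemma barrier_rate_eventually_ge_1:
  assumes "0 \<le> g" "0 \<le> A" obtains T where "\<And>t. T \<le> t \<Longrightarrow> 1 \<le> barrier_rate g A B t"
proof -
  obtain T where T_props: "0 < T" "\<And>t. T \<le> t \<Longrightarrow> zeta t \<le> 1/8" using zeta_eventually_small by blast
  have "1 \<le> barrier_rate g A B t" if t_bounds: "max T 8 \<le> t" for t
  proof -
    have "2 / t \<le> 2 / 8" using t_bounds by (intro divide_left_mono) auto
    moreover have "0 \<le> 2 * (g * t + A) / (g * t + A - B * zeta t)\<^sup>2" using assms t_bounds by simp
    moreover have "zeta t \<le> 1/8" using T_props(2) t_bounds by simp
    ultimately show ?thesis unfolding barrier_rate_def by argo
  qed
  then show thesis using that by blast
qed

lemma K_minus_barrier_bounded: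
  assumes tau_le_t: "tau \<le> t" and d_bounds: "0 < d" "d \<le> g * t + A - B * zeta t"
  shows "\<bar>K t - K_barrier g A B t (zeta t)\<bar> \<le> (Q 0)\<^sup>2 + 3 / d"
proof -
  have t_pos: "0 < t" using tau_le_t tau_pos by simp
  note zeta = zeta_pos[OF t_pos] zeta_less[OF tau_le_t]
  have "0 \<le> K_barrier g A B t (zeta t)" "K_barrier g A B t (zeta t) \<le> 3 / d"
    unfolding K_barrier_def using zeta d_bounds by (auto intro!: frac_le)
  moreover have "0 \<le> 2 * zeta t * (2 - zeta t)" using zeta by simp
  then have "0 < K t" "K t \<le> (Q 0)\<^sup>2"
    using K_pos[OF t_pos] Q_sq_eq[OF t_pos] Q_sq_antimono[of 0 t] t_pos by auto
  ultimately show ?thesis by linarith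
qed

text \<open>A deviation of K from the barrier on the wrong side would grow exponentially. The sign
  \<open>\<sigma>\<close> decides between upper barriers (1) and lower barriers (-1).\<close>

lemma K_barrier_comparison:
  fixes \<sigma> :: real
  assumes start: "tau \<le> a" and coeffs: "0 \<le> g" "0 \<le> A" and d_pos: "0 < d" and abs_sigma: "\<bar>\<sigma>\<bar> \<le> 1"
    and denom: "\<And>t. a \<le> t \<Longrightarrow> d \<le> g * t + A - B * zeta t"
    and defect: "\<And>t. a \<le> t \<Longrightarrow> \<sigma> * barrier_defect g A B t (zeta t) \<le> 0"
  shows "\<sigma> * (K a - K_barrier g A B a (zeta a)) \<le> 0"
proof -
  let ?D = "\<lambda>t. K t - K_barrier g A B t (zeta t)"
  let ?c = "\<lambda>t. 2 * zeta t / (t * (g * t + A - B * zeta t) ^ 3)"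
  obtain T where late: "\<And>t. T \<le> t \<Longrightarrow> 1 \<le> barrier_rate g A B t"
    using barrier_rate_eventually_ge_1[OF coeffs] by blast
  show ?thesis
  proof (rule bounded_imp_nonpos_if_DERIV_ge_mult[of a "\<lambda>t. \<sigma> * ?D t"
        "\<lambda>t. \<sigma> * (barrier_rate g A B t * ?D t - ?c t * barrier_defect g A B t (zeta t))"
        "barrier_rate g A B" "1 + 2 / tau" T "(Q 0)\<^sup>2 + 3 / d"])
    fix t assume "a \<le> t"
    then have t_bounds: "0 < t" "tau \<le> t" and denom_t: "d \<le> g * t + A - B * zeta t"
      and defect_t: "\<sigma> * barrier_defect g A B t (zeta t) \<le> 0"
      using start tau_pos denom defect by auto
    show "((\<lambda>t. \<sigma> * ?D t) has_real_derivative
        \<sigma> * (barrier_rate g A B t * ?D t - ?c t * barrier_defect g A B t (zeta t))) (at t)"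
      using K_minus_barrier_deriv[OF t_bounds(1), of g A B] denom_t d_pos
      by (intro DERIV_cmult) simp
    have "0 \<le> ?c t" using zeta_pos[OF t_bounds(1)] t_bounds(1) denom_t d_pos by simp
    then have "?c t * (\<sigma> * barrier_defect g A B t (zeta t)) \<le> 0"
      using defect_t by (rule mult_nonneg_nonpos)
    then show "barrier_rate g A B t * (\<sigma> * ?D t)
        \<le> \<sigma> * (barrier_rate g A B t * ?D t - ?c t * barrier_defect g A B t (zeta t))"
      by (simp add: algebra_simps)
    show "- (1 + 2 / tau) \<le> barrier_rate g A B t" using barrier_rate_ge[OF t_bounds(2) coeffs] .
    have "\<sigma> * ?D t \<le> \<bar>\<sigma>\<bar> * \<bar>?D t\<bar>" using abs_ge_self[of "\<sigma> * ?D t"] by (simp add: abs_mult)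
    also have "\<dots> \<le> 1 * \<bar>?D t\<bar>" using abs_sigma by (intro mult_right_mono) auto
    finally show "\<sigma> * ?D t \<le> (Q 0)\<^sup>2 + 3 / d"
      using K_minus_barrier_bounded[OF t_bounds(2) d_pos denom_t] by simp
  qed (rule late)
qed

end

section \<open>Two barriers for K\<close>

lemma quadratic_nonneg_on_interval:
  fixes a b k x Z :: real
  assumes "0 \<le> x" "x \<le> Z" "0 < Z" "0 \<le> a" "k * Z\<^sup>2 \<le> a" "0 \<le> a + b * Z + k * Z\<^sup>2"
  shows "0 \<le> a + b * x + k * x\<^sup>2"
proof -
  have "k * (x * Z) \<le> a"
  proof (cases "0 \<le> k")
    case True
    then have "k * (x * Z) \<le> k * Z\<^sup>2"
      unfolding power2_eq_square using assms by (intro mult_left_mono mult_right_mono) auto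
    then show ?thesis using assms(5) by simp
  next
    case False
    then have "k * (x * Z) \<le> 0" using assms by (intro mult_nonpos_nonneg) auto
    then show ?thesis using assms(4) by simp
  qed
  then have "0 \<le> x * (a + b * Z + k * Z\<^sup>2) + (Z - x) * (a - k * (x * Z))" using assms by simp
  also have "\<dots> = Z * (a + b * x + k * x\<^sup>2)" by algebra
  finally show ?thesis using assms(3) by (simp add: zero_le_mult_iff)
qed

lemma convex_quadratic_nonpos_on_interval:
  fixes a b k x Z :: real
  assumes "0 \<le> x" "x \<le> Z" "0 < Z" "a \<le> 0" "0 \<le> k" "a + b * Z + k * Z\<^sup>2 \<le> 0"
  shows "a + b * x + k * x\<^sup>2 \<le> 0"
proof -
  have "0 \<le> k * (x * Z)" using assms by simp
  then have "a - k * (x * Z) \<le> 0" using assms(4) by simp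
  with assms(2) have "(Z - x) * (a - k * (x * Z)) \<le> 0" by (intro mult_nonneg_nonpos) auto
  moreover have "x * (a + b * Z + k * Z\<^sup>2) \<le> 0" using assms by (intro mult_nonneg_nonpos)
  ultimately have "x * (a + b * Z + k * Z\<^sup>2) + (Z - x) * (a - k * (x * Z)) \<le> 0"
    by (rule add_nonpos_nonpos[rotated])
  also have "x * (a + b * Z + k * Z\<^sup>2) + (Z - x) * (a - k * (x * Z)) = Z * (a + b * x + k * x\<^sup>2)"
    by algebra
  finally show ?thesis using assms(3) by (simp add: mult_le_0_iff)
qed

text \<open>The coefficients of \<open>barrier_defect (51/50) (31/200) (1/20) t x\<close> as a quadratic in x, after the
  cubic term has been estimated by means of \<^term>\<open>x \<le> 3/2\<close>.\<close>

definition low_c0 :: "real \<Rightarrow> real" where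
  "low_c0 t = 125891/2000000 + 181133/500000 * t - 41157/125000 * t\<^sup>2 + 2601/31250 * t ^ 3"

definition low_c1 :: "real \<Rightarrow> real" where
  "low_c1 t = - 211451/4000000 - 185589/500000 * t - 84303/250000 * t\<^sup>2 + 15606/15625 * t ^ 3"

definition low_c2 :: "real \<Rightarrow> real" where
  "low_c2 t = 631/50000 + 3313/50000 * t + 357/6250 * t\<^sup>2"

lemma low_c0_nonneg: assumes "0 \<le> t" shows "0 \<le> low_c0 t"
proof -
  have "low_c0 t = 2601/31250 * t * (t - 2)\<^sup>2 + 125891/2000000 + 14669/500000 * t + 459/125000 * t\<^sup>2"
    unfolding low_c0_def by algebra
  then show ?thesis using assms by simp
qed

lemma low_quadratic_nonneg_near:
  assumes t_bounds: "2/5 \<le> t" "t \<le> 7/10" and x_bounds: "0 \<le> x" "x \<le> 1 + 461/1000 * t"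
  shows "0 \<le> low_c0 t + low_c1 t * x + low_c2 t * x\<^sup>2"
proof (rule quadratic_nonneg_on_interval[OF x_bounds])
  define r where "r = t - 2/5"
  have r_bounds: "0 \<le> r" "r \<le> 3/10" and t_eq: "t = 2/5 + r" using t_bounds by (auto simp: r_def)
  show "0 < 1 + 461/1000 * t" "0 \<le> low_c0 t" using t_bounds low_c0_nonneg by auto
  have "low_c0 t + low_c1 t * (1 + 461/1000 * t) + low_c2 t * (1 + 461/1000 * t)\<^sup>2
    = 48376223461/31250000000000 + 862897565349/12500000000000 * r
      + 1161196518689/1250000000000 * r\<^sup>2 + 437358336773/250000000000 * r ^ 3
      + 2953616397/6250000000 * r ^ 4"
    unfolding low_c0_def low_c1_def low_c2_def t_eq by algebra
  then show "0 \<le> low_c0 t + low_c1 t * (1 + 461/1000 * t) + low_c2 t * (1 + 461/1000 * t)\<^sup>2"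
    using r_bounds by simp
  have "low_c0 t - low_c2 t * (1 + 461/1000 * t)\<^sup>2
    = 724953194341/7812500000000 - 55424936089/781250000000 * r
      - 552525630389/1250000000000 * r\<^sup>2 - 734250173/250000000000 * r ^ 3
      - 75869997/6250000000 * r ^ 4"
    unfolding low_c0_def low_c2_def t_eq by algebra
  moreover have "r\<^sup>2 \<le> (3/10)\<^sup>2" "r ^ 3 \<le> (3/10) ^ 3" "r ^ 4 \<le> (3/10) ^ 4"
    using r_bounds by (intro power_mono; simp)+
  ultimately show "low_c2 t * (1 + 461/1000 * t)\<^sup>2 \<le> low_c0 t"
    using r_bounds by (simp add: power_numeral_reduce)
qed

lemma low_quadratic_nonneg_far:
  assumes t_ge: "7/10 \<le> t" and x_bounds: "0 \<le> x" "x \<le> 1 + 461/1000 * t"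
  shows "0 \<le> low_c0 t + low_c1 t * x + low_c2 t * x\<^sup>2"
proof -
  define r where "r = t - 7/10"
  have r_nonneg: "0 \<le> r" and t_eq: "t = 7/10 + r" using t_ge by (auto simp: r_def)
  have "low_c0 t + low_c1 t * (1 + 461/1000 * t)
    = 23664213907/5000000000000 + 393936372369/500000000000 * r
      + 7693404723/3125000000 * r\<^sup>2 + 2769739569/1250000000 * r ^ 3 + 3597183/7812500 * r ^ 4"
    unfolding low_c0_def low_c1_def t_eq by algebra
  then have "0 \<le> low_c0 t + low_c1 t * (1 + 461/1000 * t) + 0 * (1 + 461/1000 * t)\<^sup>2"
    using r_nonneg by simp
  from quadratic_nonneg_on_interval[OF x_bounds _ _ _ this] have "0 \<le> low_c0 t + low_c1 t * x"
    using t_ge low_c0_nonneg[of t] by simp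
  moreover have "0 \<le> low_c2 t * x\<^sup>2" using t_ge by (simp add: low_c2_def)
  ultimately show ?thesis by simp
qed

lemma barrier_defect_low_nonneg:
  assumes t_ge: "2/5 \<le> t" and x_bounds: "0 \<le> x" "x \<le> 1 + 461/1000 * t" "x \<le> 3/2"
  shows "0 \<le> barrier_defect (51/50) (31/200) (1/20) t x"
proof -
  have "barrier_defect (51/50) (31/200) (1/20) t x = low_c0 t + low_c1 t * x + low_c2 t * x\<^sup>2
      + (113/40000 + 103/10000 * t) * x\<^sup>2 * (3/2 - x) + 1/4000 * x ^ 4"
    unfolding barrier_defect_def low_c0_def low_c1_def low_c2_def by algebra
  moreover have "0 \<le> low_c0 t + low_c1 t * x + low_c2 t * x\<^sup>2"
    using low_quadratic_nonneg_near[OF t_ge _ x_bounds(1,2)]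
      low_quadratic_nonneg_far[OF _ x_bounds(1,2)] by linarith
  moreover have "0 \<le> (113/40000 + 103/10000 * t) * x\<^sup>2 * (3/2 - x) + 1/4000 * x ^ 4"
    using t_ge x_bounds by (intro add_nonneg_nonneg mult_nonneg_nonneg) auto
  ultimately show ?thesis by linarith
qed

text \<open>The coefficients of \<open>barrier_defect 1 (1/10) (47/2000) t x\<close> as a polynomial in x; its cubic
  and quartic terms have the right sign together.\<close>

definition high_c0 :: "real \<Rightarrow> real" where
  "high_c0 t = 3/125 + 9/50 * t - 3/5 * t\<^sup>2"

definition high_c1 :: "real \<Rightarrow> real" where
  "high_c1 t = - 711/50000 - 357/2500 * t - 141/1000 * t\<^sup>2 + t ^ 3"

definition high_c2 :: "real \<Rightarrow> real" where
  "high_c2 t = 7943/2500000 + 8789/400000 * t + 47/2000 * t\<^sup>2"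

lemma high_c0_nonpos: assumes "41/100 \<le> t" shows "high_c0 t \<le> 0"
proof -
  have "high_c0 t = - (153/50000 + 39/125 * (t - 41/100) + 3/5 * (t - 41/100)\<^sup>2)"
    unfolding high_c0_def by algebra
  also have "\<dots> \<le> 0"
    unfolding neg_le_0_iff_le using assms by (intro add_nonneg_nonneg mult_nonneg_nonneg) auto
  finally show ?thesis .
qed

lemma high_quadratic_nonpos_near:
  assumes t_bounds: "41/100 \<le> t" "t \<le> 1/2" and x_bounds: "0 \<le> x" "x \<le> 61/50"
  shows "high_c0 t + high_c1 t * x + high_c2 t * x\<^sup>2 \<le> 0"
proof (rule convex_quadratic_nonpos_on_interval[OF x_bounds])
  define r where "r = 1/2 - t"
  have r_bounds: "0 \<le> r" "r \<le> 9/100" and t_eq: "t = 1/2 - r" using t_bounds by (auto simp: r_def)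
  have "high_c0 t + high_c1 t * (61/50) + high_c2 t * (61/50)\<^sup>2 = - (56808551/50000000000
      + (216445269/1000000000 - 5464787/5000000 * r) * r + 61/50 * r ^ 3)"
    unfolding high_c0_def high_c1_def high_c2_def t_eq by algebra
  also have "\<dots> \<le> 0"
    unfolding neg_le_0_iff_le using r_bounds by (intro add_nonneg_nonneg mult_nonneg_nonneg) auto
  finally show "high_c0 t + high_c1 t * (61/50) + high_c2 t * (61/50)\<^sup>2 \<le> 0" .
qed (use t_bounds high_c0_nonpos in \<open>auto simp: high_c2_def\<close>)

lemma high_quadratic_nonpos_far:
  assumes t_ge: "1/2 \<le> t" and x_bounds: "0 \<le> x" "x * t\<^sup>2 \<le> 31/100"
  shows "high_c0 t + high_c1 t * x + high_c2 t * x\<^sup>2 \<le> 0"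
proof (rule convex_quadratic_nonpos_on_interval)
  define r where "r = t - 1/2"
  have r_nonneg: "0 \<le> r" and t_eq: "t = 1/2 + r" using t_ge by (auto simp: r_def)
  define Z where "Z = 31/100 / t\<^sup>2"
  show "0 < Z" "x \<le> Z" using t_ge x_bounds by (auto simp: Z_def field_simps)
  have Z_mult_t_sq: "Z * t\<^sup>2 = 31/100" using t_ge by (simp add: Z_def)
  have "t ^ 4 * (high_c0 t + high_c1 t * Z + high_c2 t * Z\<^sup>2)
    = t ^ 4 * high_c0 t + high_c1 t * (Z * t\<^sup>2) * t\<^sup>2 + high_c2 t * (Z * t\<^sup>2)\<^sup>2"
    by algebra
  also have "\<dots> = - (845991/200000000000 + 9877171/4000000000 * r + 962337/20000000 * r\<^sup>2
      + 11209/31250 * r ^ 3 + 104471/100000 * r ^ 4 + 131/100 * r ^ 5 + 3/5 * r ^ 6)"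
    unfolding Z_mult_t_sq unfolding high_c0_def high_c1_def high_c2_def t_eq by algebra
  also have "\<dots> \<le> 0"
    unfolding neg_le_0_iff_le using r_nonneg
    by (intro add_nonneg_nonneg mult_nonneg_nonneg zero_le_power) auto
  finally show "high_c0 t + high_c1 t * Z + high_c2 t * Z\<^sup>2 \<le> 0"
    using t_ge by (simp add: mult_le_0_iff)
qed (use t_ge x_bounds high_c0_nonpos in \<open>auto simp: high_c2_def\<close>)

lemma barrier_defect_high_nonpos:
  assumes t_ge: "41/100 \<le> t" and x_bounds: "0 \<le> x" "x \<le> 61/50" "x * t\<^sup>2 \<le> 31/100"
  shows "barrier_defect 1 (1/10) (47/2000) t x \<le> 0"
proof -
  have "barrier_defect 1 (1/10) (47/2000) t x = high_c0 t + high_c1 t * x + high_c2 t * x\<^sup>2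
      - x ^ 3 * (766523/2000000000 + 2209/1000000 * t - 103823/4000000000 * x)"
    unfolding barrier_defect_def high_c0_def high_c1_def high_c2_def by algebra
  moreover have "high_c0 t + high_c1 t * x + high_c2 t * x\<^sup>2 \<le> 0"
    using high_quadratic_nonpos_near[OF t_ge _ x_bounds(1,2)]
      high_quadratic_nonpos_far[OF _ x_bounds(1,3)] by linarith
  moreover have "0 \<le> x ^ 3 * (766523/2000000000 + 2209/1000000 * t - 103823/4000000000 * x)"
    using t_ge x_bounds by (intro mult_nonneg_nonneg) auto
  ultimately show ?thesis by linarith
qed

lemma barrier_defect_crude: "barrier_defect 1 0 0 t x = t\<^sup>2 * (x * t - 1)"
  unfolding barrier_defect_def by algebra

section \<open>The first zero of the inner supersolution\<close>

lemma u2_lower_ge: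
  assumes "0 \<le> d" "d \<le> 1" "2 * d \<le> c"
  shows "13/10 + 3/10 * c \<le> u2_lower (1 - d) c"
proof -
  have "u2_lower (1 - d) c = 13/10 + 3/10 * c + 7/10 * d * (c - 2 * d) + d * (3/10 - 1/10 * d - 1/10 * d\<^sup>2)"
    unfolding u2_lower_def by algebra
  moreover have "d\<^sup>2 \<le> 1" using assms by (simp add: power_le_one)
  then have "0 \<le> d * (3/10 - 1/10 * d - 1/10 * d\<^sup>2)" using assms by (intro mult_nonneg_nonneg) auto
  moreover have "0 \<le> 7/10 * d * (c - 2 * d)" using assms by simp
  ultimately show ?thesis by linarith
qed

lemma u2_upper_le:
  assumes k_bounds: "41/100 \<le> k" "k \<le> 461/1000" and c_bounds: "9/100 \<le> c" "k * c \<le> 1"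
  shows "u2_upper (1 - k * c) c \<le> 689/500 + 1011/2500 * c + 1773/10000 * c\<^sup>2"
proof -
  define d where "d = k * c"
  have d_bounds: "0 \<le> d" "d \<le> 1" "d \<le> 461/1000 * c" "41/100 * c \<le> d"
    using k_bounds c_bounds by (auto simp: d_def intro: mult_right_mono)
  have "d * (- 17/500 + 19/25 * c - 229/250 * d) \<le> d * (- 17/500 + 9611/25000 * c)"
    using d_bounds by (intro mult_left_mono) auto
  also have "\<dots> \<le> 461/1000 * c * (- 17/500 + 9611/25000 * c)"
    using d_bounds c_bounds by (intro mult_right_mono) auto
  also have "\<dots> \<le> - 39/2500 * c + 1773/10000 * c\<^sup>2"
    using c_bounds zero_le_power2[of c] by (simp add: power2_eq_square algebra_simps)
  moreover have "u2_upper (1 - d) c = 689/500 + 21/50 * c + d * (- 17/500 + 19/25 * c - 229/250 * d)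
      - (9/50 * c * d\<^sup>2 + d ^ 3 * (157/250 - 1/4 * d + 1/20 * d\<^sup>2))"
    unfolding u2_upper_def by algebra
  moreover have "0 \<le> 9/50 * c * d\<^sup>2 + d ^ 3 * (157/250 - 1/4 * d + 1/20 * d\<^sup>2)"
    using d_bounds c_bounds by (intro add_nonneg_nonneg mult_nonneg_nonneg) auto
  ultimately show ?thesis unfolding d_def by linarith
qed

lemma tau_exclusion_polynomial_pos:
  fixes t :: real
  assumes "251/500 \<le> t" "t \<le> 47/50"
  shows "0 < (t\<^sup>2 * (2 - 1063/2500 * t\<^sup>2) - (689/500 + 1011/2500 * t\<^sup>2 + 1773/10000 * t ^ 4))
      * (1999/2000 * t + 21/200) + 2 * t\<^sup>2 * (1 + (2293/5000 - 51/1000 * t\<^sup>2) * t)"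
    (is "0 < ?p")
proof -
  define h where "h = t - 1/2"
  have h_bounds: "1/500 \<le> h" "h \<le> 11/25" and t_eq: "t = 1/2 + h" using assms by (auto simp: h_def)
  have "0 \<le> h\<^sup>2 * (396831929/80000000 + 24999213/40000000 * h - 583603/320000 * h\<^sup>2 - 563359/800000 * h ^ 3)"
  proof -
    have "h\<^sup>2 \<le> 1" "h ^ 3 \<le> 1" using h_bounds by (auto simp: power_le_one)
    then show ?thesis using h_bounds by (intro mult_nonneg_nonneg) auto
  qed
  moreover have "?p = - 2189339/640000000 + 775211293/320000000 * h
      + h\<^sup>2 * (396831929/80000000 + 24999213/40000000 * h - 583603/320000 * h\<^sup>2 - 563359/800000 * h ^ 3)"
    unfolding t_eq by algebra
  ultimately show ?thesis using h_bounds by simp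
qed

text \<open>Since \<^term>\<open>zeta\<close> decreases at most at the rate forced by the lower barrier, it stays below the
  reciprocal of this quartic, fitted to the solution of the limiting equation.\<close>

definition recip_path :: "real \<Rightarrow> real" where
  "recip_path t = t\<^sup>2 * (323/100 + 15/2 * (t - 1/2)\<^sup>2)"

definition drecip_path :: "real \<Rightarrow> real" where
  "drecip_path t = 2 * t * (323/100 + 15/2 * (t - 1/2)\<^sup>2) + 15 * t\<^sup>2 * (t - 1/2)"

lemma recip_path_ge: "323/100 * t\<^sup>2 \<le> recip_path t"
  using mult_nonneg_nonneg[of "t\<^sup>2" "15/2 * (t - 1/2)\<^sup>2"]
  by (simp add: recip_path_def algebra_simps)

lemma recip_path_deriv: "(recip_path has_real_derivative drecip_path t) (at t)"
  unfolding recip_path_def[abs_def] drecip_path_def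
  by (auto intro!: derivative_eq_intros simp: power2_eq_square)

lemma recip_path_flow:
  assumes "1/2 \<le> t"
  shows "(drecip_path t + 1 - 2 * recip_path t) * ((51/50 * t + 31/200) * recip_path t - 1/20)
    < 2 * (recip_path t)\<^sup>2"
proof -
  define h where "h = t - 1/2"
  have h_nonneg: "0 \<le> h" and t_eq: "t = 1/2 + h" using assms by (auto simp: h_def)
  have "2 * (recip_path t)\<^sup>2
      - (drecip_path t + 1 - 2 * recip_path t) * ((51/50 * t + 31/200) * recip_path t - 1/20)
    = 490243/16000000 + 27/10 * h\<^sup>2 * (1 - h)\<^sup>2 + 83/100 * h * (1 - 61/5 * h ^ 3)\<^sup>2
      + 29 * h ^ 6 * (1 - 5/2 * h)\<^sup>2
      + 47703/8000000 * h + 134109/4000000 * h ^ 2 + 46403/4000000 * h ^ 3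
      + 160067/4000000 * h ^ 4 + 49863/31250 * h ^ 5 + 7/100 * h ^ 6 + 144751/1250 * h ^ 7
      + 97/16 * h ^ 8 + 459/4 * h ^ 9"
    unfolding recip_path_def drecip_path_def t_eq by algebra
  also have "\<dots> > 0"
    using h_nonneg by (intro add_pos_nonneg mult_nonneg_nonneg) auto
  finally show ?thesis by simp
qed

context ground_state begin

lemma
  shows kappa_tau_sq_nonneg: "0 \<le> kappa * tau\<^sup>2" and kappa_tau_sq_le_1: "kappa * tau\<^sup>2 \<le> 1"
    and kappa_tau_sq_le: "2 * (kappa * tau\<^sup>2) \<le> tau\<^sup>2"
proof -
  have "kappa * tau\<^sup>2 \<le> 1/2 * tau\<^sup>2" using kappa_bounds by (intro mult_right_mono) auto
  then show "2 * (kappa * tau\<^sup>2) \<le> tau\<^sup>2" "kappa * tau\<^sup>2 \<le> 1" using tau_sq_less by auto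
qed (use kappa_bounds in simp)

lemma u_tau_sq_ge: "13/10 + 3/10 * tau\<^sup>2 \<le> (u tau)\<^sup>2"
  using u2_lower_ge[of "kappa * tau\<^sup>2" "tau\<^sup>2"] kappa_tau_sq_nonneg kappa_tau_sq_le_1 kappa_tau_sq_le
    u_sq_ge_lower[of tau] tau_pos
  by (simp add: rho_tau)

lemma kappa_le: "kappa \<le> 461/1000 - 42/1000 * tau\<^sup>2"
  using u_tau_sq_ge zero_le_power2[of tau] unfolding kappa_eq by linarith

lemma kappa_le_const: "kappa \<le> 461/1000"
  using kappa_le zero_le_power2[of tau] by linarith

lemma kappa_tau_le: "kappa * tau \<le> 11/1000 + 429/1000 * tau"
proof -
  have "kappa * tau \<le> (461/1000 - 42/1000 * tau\<^sup>2) * tau"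
    using kappa_le tau_pos by (intro mult_right_mono) auto
  also have "\<dots> = 11/1000 + 429/1000 * tau
      - (42/1000 * (tau - 1/2)\<^sup>2 * (tau + 1) + 1/2000 * (1 - tau))"
    by algebra
  also have "\<dots> \<le> 11/1000 + 429/1000 * tau - 0"
    using tau_pos tau_less_1 by (intro diff_left_mono add_nonneg_nonneg mult_nonneg_nonneg) auto
  finally show ?thesis by simp
qed

lemma zeta_le: "tau \<le> t \<Longrightarrow> zeta t \<le> 1011/1000 + 429/1000 * tau"
  using zeta_le_zeta_tau[of t] kappa_tau_le by (simp add: zeta_tau)

lemma K_ge_low_barrier:
  assumes t_bounds: "tau \<le> t" "41/100 \<le> t"
  shows "K_barrier (51/50) (31/200) (1/20) t (zeta t) \<le> K t"
proof -
  have "- 1 * (K t - K_barrier (51/50) (31/200) (1/20) t (zeta t)) \<le> 0"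
  proof (rule K_barrier_comparison[where d = "1/4"])
    fix s assume "t \<le> s"
    then have s_bounds: "tau \<le> s" "0 < s" "41/100 \<le> s" using t_bounds tau_pos by auto
    show "1/4 \<le> 51/50 * s + 31/200 - 1/20 * zeta s" using zeta_less[OF s_bounds(1)] s_bounds by simp
    have "0 \<le> barrier_defect (51/50) (31/200) (1/20) s (zeta s)"
      using zeta_pos[OF s_bounds(2)] zeta_less[OF s_bounds(1)] zeta_le[OF s_bounds(1)] s_bounds
      by (intro barrier_defect_low_nonneg) auto
    then show "- 1 * barrier_defect (51/50) (31/200) (1/20) s (zeta s) \<le> 0" by simp
  qed (use t_bounds in auto)
  then show ?thesis by simp
qed

lemma u_tau_sq_eq: "(u tau)\<^sup>2 = tau\<^sup>2 * (2 - 2 * kappa\<^sup>2 * tau\<^sup>2 + K tau)"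
  unfolding u_def power_mult_distrib Q_sq_eq[OF tau_pos] zeta_tau by algebra

lemma u_tau_sq_le:
  assumes "3/10 \<le> tau"
  shows "(u tau)\<^sup>2 \<le> 689/500 + 1011/2500 * tau\<^sup>2 + 1773/10000 * tau ^ 4"
proof -
  have "(3/10)\<^sup>2 \<le> tau\<^sup>2" using assms by (intro power_mono) auto
  then have "u2_upper (1 - kappa * tau\<^sup>2) (tau\<^sup>2)
      \<le> 689/500 + 1011/2500 * tau\<^sup>2 + 1773/10000 * (tau\<^sup>2)\<^sup>2"
    using kappa_bounds(1) kappa_le_const kappa_tau_sq_le_1
    by (intro u2_upper_le) (auto simp: power2_eq_square)
  then show ?thesis
    using u_sq_le_upper[of tau] tau_pos tau_less_tmax by (simp add: rho_tau flip: power_mult)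
qed

lemma kappa_ge:
  assumes "3/10 \<le> tau" shows "2293/5000 - 51/1000 * tau\<^sup>2 \<le> kappa"
proof -
  have "tau\<^sup>2 * tau\<^sup>2 \<le> 7/8 * tau\<^sup>2" using tau_sq_less by (intro mult_right_mono) auto
  then have "tau ^ 4 \<le> 7/8 * tau\<^sup>2" by (simp add: power4_eq_xxxx power2_eq_square)
  then show ?thesis
    using u_tau_sq_le[OF assms] zero_le_power2[of tau] unfolding kappa_eq by linarith
qed

lemma tau_less: "tau < 251/500"
proof (rule ccontr)
  assume "\<not> tau < 251/500"
  then have tau_ge_bound: "251/500 \<le> tau" by simp
  define s where "s = 51/50 * tau + 31/200 - 1/20 * zeta tau"
  define s' where "s' = 1999/2000 * tau + 21/200"
  define k where "k = 2293/5000 - 51/1000 * tau\<^sup>2"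
  have "41/100 * tau \<le> kappa * tau" using kappa_bounds tau_pos by (intro mult_right_mono) auto
  then have s_le_s': "s \<le> s'" by (simp add: s_def s'_def zeta_tau field_simps)
  have s_pos: "0 < s" using tau_ge_bound zeta_tau_less by (simp add: s_def)
  have k_tau_le: "k * tau \<le> kappa * tau"
    using kappa_ge tau_ge_bound tau_pos by (intro mult_right_mono) (auto simp: k_def)
  have "2 * zeta tau \<le> K tau * s"
    using K_ge_low_barrier[of tau] tau_ge_bound s_pos
    by (simp add: K_barrier_def s_def pos_divide_le_eq)
  also have "\<dots> \<le> K tau * s'" using s_le_s' K_pos[OF tau_pos] by (intro mult_left_mono) auto
  finally have K_mult_le: "2 * (1 + k * tau) \<le> K tau * s'" using k_tau_le by (simp add: zeta_tau)
  have "kappa\<^sup>2 \<le> (461/1000)\<^sup>2" using kappa_bounds(1) kappa_le_const by (intro power_mono) auto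
  then have "kappa\<^sup>2 * tau\<^sup>2 \<le> 1063/5000 * tau\<^sup>2"
    by (intro mult_right_mono) (auto simp: power2_eq_square)
  then have "(2 - 1063/2500 * tau\<^sup>2) * s' \<le> (2 - 2 * kappa\<^sup>2 * tau\<^sup>2) * s'"
    using s_le_s' s_pos by (intro mult_right_mono) auto
  then have "tau\<^sup>2 * ((2 - 1063/2500 * tau\<^sup>2) * s' + 2 * (1 + k * tau))
      \<le> tau\<^sup>2 * ((2 - 2 * kappa\<^sup>2 * tau\<^sup>2) * s' + K tau * s')"
    using K_mult_le by (intro mult_left_mono add_mono) auto
  also have "\<dots> = (u tau)\<^sup>2 * s'" unfolding u_tau_sq_eq by algebra
  also have "\<dots> \<le> (689/500 + 1011/2500 * tau\<^sup>2 + 1773/10000 * tau ^ 4) * s'"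
    using u_tau_sq_le tau_ge_bound s_le_s' s_pos by (intro mult_right_mono) auto
  finally have "(tau\<^sup>2 * (2 - 1063/2500 * tau\<^sup>2) - (689/500 + 1011/2500 * tau\<^sup>2 + 1773/10000 * tau ^ 4)) * s'
      + 2 * tau\<^sup>2 * (1 + k * tau) \<le> 0"
    by (simp add: algebra_simps)
  moreover have "tau \<le> 47/50"
    using tau_sq_less by (intro power2_le_imp_le[of tau "47/50"]) (auto simp: power2_eq_square)
  ultimately show False using tau_exclusion_polynomial_pos[OF tau_ge_bound] by (simp add: s'_def k_def)
qed

lemma zeta_le_const: "tau \<le> t \<Longrightarrow> zeta t \<le> 1227/1000"
  using zeta_le[of t] tau_less by simp

lemma recip_path_mult_zeta_le_1:
  assumes "251/500 \<le> t" shows "recip_path t * zeta t \<le> 1"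
proof (rule le_if_decreasing_at_crossing[OF assms])
  have "recip_path (251/500) * zeta (251/500) \<le> recip_path (251/500) * (1227/1000)"
    using zeta_le_const[of "251/500"] tau_less by (intro mult_left_mono) (auto simp: recip_path_def)
  also have "\<dots> \<le> 1" by (simp add: recip_path_def power2_eq_square)
  finally show "recip_path (251/500) * zeta (251/500) \<le> 1" .
next
  fix s assume "251/500 \<le> s" "s \<le> t"
  then have s_bounds: "0 < s" "tau \<le> s" "41/100 \<le> s" "1/2 \<le> s" using tau_less by auto
  define X where "X = recip_path s"
  define S where "S = (51/50 * s + 31/200) * X - 1/20"
  show "((\<lambda>t. recip_path t * zeta t) has_real_derivative
      drecip_path s * zeta s - X * (zeta s * (2 - zeta s) + K s)) (at s)"
    unfolding X_def using recip_path_deriv[of s] zeta_deriv[OF s_bounds(1)]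
    by (auto intro!: derivative_eq_intros simp: algebra_simps)
  assume "recip_path s * zeta s = 1"
  then have X_mult_zeta: "X * zeta s = 1" by (simp add: X_def)
  then have X_pos: "0 < X"
    using zeta_pos[OF s_bounds(1)] by (metis zero_less_mult_pos2 zero_less_one)
  have S_eq: "S = X * (51/50 * s + 31/200 - 1/20 * zeta s)"
    using X_mult_zeta by (simp add: S_def algebra_simps)
  moreover have "0 < 51/50 * s + 31/200 - 1/20 * zeta s"
    using zeta_less[OF s_bounds(2)] s_bounds by simp
  ultimately have S_pos: "0 < S" using X_pos by simp
  have "51/50 * s + 31/200 - 1/20 * zeta s = S * zeta s" using X_mult_zeta S_eq by algebra
  then have "K_barrier (51/50) (31/200) (1/20) s (zeta s) = 2 / S"
    using zeta_pos[OF s_bounds(1)] by (simp add: K_barrier_def)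
  then have "2 / S \<le> K s" using K_ge_low_barrier[OF s_bounds(2,3)] by simp
  then have "X\<^sup>2 * (2 / S) \<le> X\<^sup>2 * K s" by (intro mult_left_mono) auto
  moreover have "drecip_path s + 1 - 2 * X < 2 * X\<^sup>2 / S"
    using recip_path_flow[OF s_bounds(4)] S_pos by (simp add: X_def S_def pos_less_divide_eq)
  ultimately have "drecip_path s + 1 - 2 * X - X\<^sup>2 * K s < 0" by (simp add: mult.commute)
  then have "zeta s * (drecip_path s + 1 - 2 * X - X\<^sup>2 * K s) < 0"
    using zeta_pos[OF s_bounds(1)] by (intro mult_pos_neg)
  moreover have "zeta s * (drecip_path s + 1 - 2 * X - X\<^sup>2 * K s)
      = drecip_path s * zeta s - X * (zeta s * (2 - zeta s) + K s)"
    using X_mult_zeta by algebra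
  ultimately show "drecip_path s * zeta s - X * (zeta s * (2 - zeta s) + K s) < 0" by simp
qed

lemma zeta_mult_t_sq_le: assumes "tau \<le> t" shows "zeta t * t\<^sup>2 \<le> 31/100"
proof (cases "t \<le> 251/500")
  case True
  then have t_bounds: "0 < t" "t\<^sup>2 \<le> (251/500)\<^sup>2" using assms tau_pos by (auto intro!: power_mono)
  then have "zeta t * t\<^sup>2 \<le> 1227/1000 * (251/500)\<^sup>2"
    using zeta_le_const[OF assms] by (intro mult_mono) auto
  then show ?thesis by (simp add: power2_eq_square)
next
  case False
  then have "zeta t * (323/100 * t\<^sup>2) \<le> zeta t * recip_path t"
    using recip_path_ge zeta_pos[of t] by (intro mult_left_mono) auto
  then show ?thesis using recip_path_mult_zeta_le_1[of t] False by (simp add: mult.commute)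
qed

lemma zeta_mult_t_le: assumes "tau \<le> t" shows "zeta t * t \<le> 1"
proof -
  have t_pos: "0 < t" using assms tau_pos by simp
  have "(zeta t * t)\<^sup>2 = zeta t * (zeta t * t\<^sup>2)" by algebra
  also have "\<dots> \<le> 1227/1000 * (31/100)"
    using zeta_le_const[OF assms] zeta_mult_t_sq_le[OF assms] zeta_pos[OF t_pos] t_pos
    by (intro mult_mono) auto
  finally show ?thesis by (intro power2_le_imp_le[of "zeta t * t" 1]) auto
qed

lemma tau_ge: "41/100 \<le> tau"
proof (rule ccontr)
  assume "\<not> 41/100 \<le> tau"
  then have tau_less_41: "tau < 41/100" by simp
  have "1 * (K tau - K_barrier 1 0 0 tau (zeta tau)) \<le> 0"
  proof (rule K_barrier_comparison[where d = tau])
    fix s assume "tau \<le> s"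
    then show "1 * barrier_defect 1 0 0 s (zeta s) \<le> 0"
      using zeta_mult_t_le by (simp add: barrier_defect_crude mult_nonneg_nonpos)
  qed (use tau_pos in auto)
  then have "tau * K tau \<le> 2 * zeta tau" using tau_pos by (simp add: K_barrier_def field_simps)
  then have "tau * (tau * K tau) \<le> tau * (2 * zeta tau)"
    using tau_pos by (intro mult_left_mono) auto
  also have "\<dots> = 2 * tau + 2 * (kappa * tau\<^sup>2)" unfolding zeta_tau by algebra
  moreover have "(u tau)\<^sup>2 = 2 * tau\<^sup>2 - 2 * (kappa * tau\<^sup>2)\<^sup>2 + tau * (tau * K tau)"
    unfolding u_tau_sq_eq by algebra
  moreover have "0 \<le> (kappa * tau\<^sup>2)\<^sup>2" by simp
  moreover have "tau\<^sup>2 \<le> (41/100)\<^sup>2" using tau_less_41 tau_pos by (intro power_mono) auto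
  then have "tau\<^sup>2 \<le> 1681/10000" by (simp add: power2_eq_square)
  ultimately show False using u_tau_sq_ge kappa_tau_sq_le tau_less_41 by linarith
qed

end

section \<open>A supersolution on the outer half-line\<close>

text \<open>The comparison function is \<open>1 - weight t * (Q t)\<^sup>2\<close>. The coefficients were chosen by linear
  programming: the inequalities below are linear in them.\<close>

definition weight :: "real \<Rightarrow> real" where
  "weight t = 23/500 + 249/1000 * t - 69/2000 * t\<^sup>2 + 1/500 * t ^ 3"

definition dweight :: "real \<Rightarrow> real" where
  "dweight t = 249/1000 - 69/1000 * t + 3/500 * t\<^sup>2"

definition ddweight :: "real \<Rightarrow> real" where
  "ddweight t = - 69/1000 + 3/250 * t"

lemma weight_deriv: "(weight has_real_derivative dweight t) (at t)"
  and dweight_deriv: "(dweight has_real_derivative ddweight t) (at t)"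
  unfolding weight_def[abs_def] dweight_def[abs_def] ddweight_def
  by (auto intro!: derivative_eq_intros)

lemma weight_pos: assumes "0 \<le> t" shows "0 < weight t"
proof -
  have "weight t = 23/500 + 1/500 * t * (t - 69/8)\<^sup>2 + 3207/32000 * t"
    unfolding weight_def by algebra
  also have "\<dots> > 0" using assms by (intro add_pos_nonneg mult_nonneg_nonneg) auto
  finally show ?thesis .
qed

lemma dweight_le: assumes "41/100 \<le> t" shows "dweight t \<le> 2 * weight t"
proof -
  define h where "h = t - 41/100"
  have h_nonneg: "0 \<le> h" and t_eq: "t = 41/100 + h" using assms by (auto simp: h_def)
  have "2 * weight t - dweight t
      = 7892273/125000000 + 501417/2500000 * h + 1/250 * h * (h - 219/25)\<^sup>2"
    unfolding weight_def dweight_def t_eq by algebra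
  also have "\<dots> \<ge> 0" using h_nonneg by (intro add_nonneg_nonneg mult_nonneg_nonneg) auto
  finally show ?thesis by simp
qed

lemma weight_start_outer:
  assumes "41/100 \<le> t" "t \<le> 243/500"
  defines "s \<equiv> 381/5000 + 9899/10000 * t"
  shows "weight t * ((2 - 1989/5000 * t\<^sup>2) * s + 2 * (1011/1000 + 429/1000 * t)) < s"
proof -
  define r where "r = 1/2 - t"
  have r_bounds: "7/500 \<le> r" "r \<le> 9/100" and t_eq: "t = 1/2 - r" using assms by (auto simp: r_def)
  have "s - weight t * ((2 - 1989/5000 * t\<^sup>2) * s + 2 * (1011/1000 + 429/1000 * t))
    = 1316277294337029/5000000000000000000 + 721809084386421/5000000000000000 * (r - 7/500)
      + 7097013954729/20000000000000 * (r - 7/500) * (9/100 - r)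
      + 54006921781/200000000000 * r\<^sup>2 * (9/100 - r) + 12094321667/200000000000 * r ^ 4
      + 223243371/20000000000 * r ^ 5 + 19689111/25000000000 * r ^ 6"
    unfolding s_def weight_def t_eq by algebra
  also have "\<dots> > 0" using r_bounds by (intro add_pos_nonneg mult_nonneg_nonneg) auto
  finally show ?thesis by simp
qed

lemma weight_start_inner:
  assumes "243/500 \<le> t" "t \<le> 251/500"
  shows "weight t * (689/500 + 1011/2500 * t\<^sup>2 + 1773/10000 * t ^ 4) < t\<^sup>2"
proof -
  define r where "r = 1/2 - t"
  have r_bounds: "- 1/500 \<le> r" "r \<le> 7/500" and t_eq: "t = 1/2 - r" using assms by (auto simp: r_def)
  have "\<bar>r\<bar> \<le> 1/50" using r_bounds by simp
  then have "r\<^sup>2 \<le> (1/50)\<^sup>2" "\<bar>r ^ 3\<bar> \<le> (1/50) ^ 3"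
    unfolding power_abs by (auto intro!: power_mono simp: abs_le_square_iff[symmetric])
  then have small: "0 \<le> 1/1000 - 272667/3200000 * r\<^sup>2 + 71169/2500000 * r ^ 3"
    by (simp add: power_numeral_reduce abs_le_iff)
  have "t\<^sup>2 - weight t * (689/500 + 1011/2500 * t\<^sup>2 + 1773/10000 * t ^ 4)
    = 480830107057/2500000000000000 + 1437406060599/2500000000000 * (7/500 - r)
      + 2073454867/2500000000 * (7/500 - r)\<^sup>2
      + r\<^sup>2 * (15178753/80000000 * (r + 1/500) + 1/1000)
      + r\<^sup>2 * (1/1000 - 272667/3200000 * r\<^sup>2 + 71169/2500000 * r ^ 3)
      + r ^ 6 * (19503/4000000 + 1773/5000000 * r)"
    unfolding weight_def t_eq by algebra
  also have "\<dots> > 0" using r_bounds small by (intro add_pos_nonneg mult_nonneg_nonneg) auto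
  finally show ?thesis by simp
qed

definition outer_base :: "real \<Rightarrow> real" where
  "outer_base t = 69/250 + 433/500 * t - 91/50 * t\<^sup>2 + 249/250 * t ^ 3 - 73/500 * t ^ 4 + 1/125 * t ^ 5"

definition outer_slope :: "real \<Rightarrow> real" where
  "outer_slope t = 46/125 * t + 249/250 * t\<^sup>2 - 1/125 * t ^ 4"

lemma outer_base_eq:
  "outer_base t = t\<^sup>2 * ddweight t - 4 * (t\<^sup>2 + t) * dweight t + weight t * (4 * t\<^sup>2 + 8 * t + 6) - 3 * t\<^sup>2"
  unfolding outer_base_def weight_def dweight_def ddweight_def by algebra

lemma outer_slope_eq: "outer_slope t = 8 * t * weight t - 4 * t\<^sup>2 * dweight t"
  unfolding outer_slope_def weight_def dweight_def by algebra

text \<open>A positive multiple of the defect of the comparison function, with K replaced by its lower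
  barrier and \<^term>\<open>x\<close> in place of zeta.\<close>

definition outer_defect :: "real \<Rightarrow> real \<Rightarrow> real" where
  "outer_defect t x = (outer_base t - outer_slope t * x) * (51/50 * t + 31/200 - 1/20 * x)
    + 2 * t\<^sup>2 * weight t * x"

lemma outer_defect_nonneg_below:
  assumes "0 \<le> x" "x \<le> Z" "0 < Z" "0 \<le> outer_defect t Z"
    and "0 \<le> outer_base t * (51/50 * t + 31/200)"
      "1/20 * outer_slope t * Z\<^sup>2 \<le> outer_base t * (51/50 * t + 31/200)"
  shows "0 \<le> outer_defect t x"
proof -
  let ?b = "2 * t\<^sup>2 * weight t - outer_slope t * (51/50 * t + 31/200) - 1/20 * outer_base t"
  have outer_defect_eq: "outer_defect t y
      = outer_base t * (51/50 * t + 31/200) + ?b * y + 1/20 * outer_slope t * y\<^sup>2" for y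
    unfolding outer_defect_def by algebra
  show ?thesis
    using quadratic_nonneg_on_interval[OF assms(1-3,5,6), of ?b] assms(4) unfolding outer_defect_eq by simp
qed

lemma outer_slope_nonneg: assumes "0 \<le> t" "t \<le> 1" shows "0 \<le> outer_slope t"
proof -
  have "t ^ 4 \<le> t" using power_decreasing[of 1 4 t] assms by simp
  moreover have "0 \<le> t\<^sup>2" by simp
  ultimately show ?thesis unfolding outer_slope_def using assms by linarith
qed

lemma outer_slope_le_base:
  assumes "41/100 \<le> t" "t \<le> 1"
  shows "5/64 * outer_slope t \<le> outer_base t * (51/50 * t + 31/200)"
proof -
  define r where "r = 1 - t"
  have r_bounds: "0 \<le> r" "r \<le> 59/100" and t_eq: "t = 1 - r" using assms by (auto simp: r_def)
  have "r\<^sup>2 \<le> (59/100)\<^sup>2" using r_bounds by (intro power_mono) auto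
  then have "r\<^sup>2 * r \<le> 3481/10000 * r"
    using r_bounds by (intro mult_right_mono) (auto simp: power2_eq_square)
  then have "r ^ 3 \<le> 3481/10000 * r" by (simp add: power2_eq_square power3_eq_cube)
  moreover have "0 \<le> r\<^sup>2" "0 \<le> r ^ 4" "0 \<le> r ^ 5" "0 \<le> r ^ 6" using r_bounds by auto
  moreover have "outer_base t * (51/50 * t + 31/200) - 5/64 * outer_slope t
    = 1689/16000 + 15441/40000 * r + 423/16000 * r\<^sup>2 - 24001/25000 * r ^ 3 + 75583/200000 * r ^ 4
      + 617/6250 * r ^ 5 + 51/6250 * r ^ 6"
    unfolding outer_base_def outer_slope_def t_eq by algebra
  ultimately show ?thesis using r_bounds by linarith
qed

lemma outer_base_nonneg_far: assumes "1 \<le> t" shows "0 \<le> outer_base t"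
proof -
  define h where "h = t - 1"
  have h_nonneg: "0 \<le> h" and t_eq: "t = 1 + h" using assms by (auto simp: h_def)
  have "outer_base t = 9/50 * (1 - 11/12 * h)\<^sup>2 + 1/125 * h ^ 3 * (h - 53/8)\<^sup>2
      + 883/4000 * h\<^sup>2 + 1127/8000 * h ^ 3"
    unfolding outer_base_def t_eq by algebra
  also have "\<dots> \<ge> 0" using h_nonneg by (intro add_nonneg_nonneg mult_nonneg_nonneg) auto
  finally show ?thesis .
qed

lemma outer_slope_le_base_far:
  assumes "1 \<le> t" shows "1/500 * outer_slope t \<le> outer_base t * (51/50 * t + 31/200)"
proof -
  define h where "h = t - 1"
  have h_nonneg: "0 \<le> h" and t_eq: "t = 1 + h" using assms by (auto simp: h_def)
  have "outer_base t * (51/50 * t + 31/200) - 1/500 * outer_slope t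
    = 1/5 * (1 - 21/40 * h)\<^sup>2 + 51/6250 * h ^ 4 * (h - 61/10)\<^sup>2 + 2197/250000 + 597/500000 * h
      + 43479/1000000 * h\<^sup>2 + 239401/250000 * h ^ 3 + 184181/2500000 * h ^ 4 + 13/15625 * h ^ 5"
    unfolding outer_base_def outer_slope_def t_eq by algebra
  also have "\<dots> \<ge> 0" using h_nonneg by (intro add_nonneg_nonneg mult_nonneg_nonneg) auto
  finally show ?thesis by simp
qed

lemma outer_defect_nonneg_below_near:
  assumes "41/100 \<le> t" "t \<le> 1" "0 \<le> x" "x \<le> Z" "0 < Z" "Z \<le> 5/4" "0 \<le> outer_defect t Z"
  shows "0 \<le> outer_defect t x"
proof (rule outer_defect_nonneg_below[OF assms(3-5,7)])
  have slope: "0 \<le> outer_slope t" using outer_slope_nonneg assms by simp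
  then show "0 \<le> outer_base t * (51/50 * t + 31/200)"
    using outer_slope_le_base[of t] assms(1,2) by linarith
  have "Z\<^sup>2 \<le> (5/4)\<^sup>2" using assms by (intro power_mono) auto
  then have "1/20 * outer_slope t * Z\<^sup>2 \<le> 1/20 * outer_slope t * (5/4)\<^sup>2"
    using slope by (intro mult_left_mono) auto
  also have "\<dots> = 5/64 * outer_slope t" by (simp add: power2_eq_square)
  finally show "1/20 * outer_slope t * Z\<^sup>2 \<le> outer_base t * (51/50 * t + 31/200)"
    using outer_slope_le_base[of t] assms by simp
qed

lemma outer_defect_nonneg_below_far:
  assumes "1 \<le> t" "0 \<le> x" "x \<le> Z" "0 < Z" "Z \<le> 1/5" "0 \<le> outer_defect t Z"
  shows "0 \<le> outer_defect t x"
proof (rule outer_defect_nonneg_below[OF assms(2-4,6)])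
  show base: "0 \<le> outer_base t * (51/50 * t + 31/200)"
    using outer_base_nonneg_far assms(1) by simp
  show "1/20 * outer_slope t * Z\<^sup>2 \<le> outer_base t * (51/50 * t + 31/200)"
  proof (cases "0 \<le> outer_slope t")
    case True
    have "Z\<^sup>2 \<le> (1/5)\<^sup>2" using assms by (intro power_mono) auto
    then have "1/20 * outer_slope t * Z\<^sup>2 \<le> 1/20 * outer_slope t * (1/5)\<^sup>2"
      using True by (intro mult_left_mono) auto
    also have "\<dots> = 1/500 * outer_slope t" by (simp add: power2_eq_square)
    finally show ?thesis using outer_slope_le_base_far[OF assms(1)] by simp
  next
    case False
    then have "1/20 * outer_slope t * Z\<^sup>2 \<le> 0" by (simp add: mult_nonpos_nonneg)
    then show ?thesis using base by simp
  qed
qed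

lemma outer_defect_near:
  assumes "41/100 \<le> t" "t \<le> 251/500" shows "0 \<le> outer_defect t (1227/1000)"
proof -
  define r where "r = 1/2 - t"
  have r_bounds: "- 1/500 \<le> r" "r \<le> 9/100" and t_eq: "t = 1/2 - r" using assms by (auto simp: r_def)
  have "outer_defect t (1227/1000)
    = 386467214767/625000000000000 + 388293340499/625000000000 * (r + 1/500)
      + 2662914179/1250000000 * (r + 1/500) * (9/100 - r)
      + r\<^sup>2 * (1092914879/1250000000 * r + 1/500)
      + r ^ 4 * (1539942921/2500000000 + 1359631/12500000 * r) + 51/6250 * r ^ 6"
    unfolding outer_defect_def outer_base_def outer_slope_def weight_def t_eq by algebra
  also have "\<dots> > 0" using r_bounds by (intro add_pos_nonneg mult_nonneg_nonneg) auto
  finally show ?thesis by simp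
qed

definition outer_path_defect :: "real \<Rightarrow> real" where
  "outer_path_defect t = (outer_base t * recip_path t - outer_slope t)
      * ((51/50 * t + 31/200) * recip_path t - 1/20) + 2 * t\<^sup>2 * weight t * recip_path t"

lemma outer_path_defect_nonneg_mid:
  assumes "1/2 \<le> t" "t \<le> 1" shows "0 \<le> outer_path_defect t"
proof -
  define h where "h = t - 1/2"
  have h_bounds: "0 \<le> h" "h \<le> 1/2" and t_eq: "t = 1/2 + h" using assms by (auto simp: h_def)
  define p where "p = 48153449/128000000000 + 2841809083/64000000000 * h + 641994351/3200000000 * h ^ 2
      + 560065953/1600000000 * h ^ 3 + 44013053729/32000000000 * h ^ 4 - 12809471357/16000000000 * h ^ 5
      - 60026010047/8000000000 * h ^ 6 - 20536250709/4000000000 * h ^ 7 - 4420646293/2000000000 * h ^ 8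
      + 8547145089/1000000000 * h ^ 9 + 164439327/4000000 * h ^ 10 + 54341829/2000000 * h ^ 11
      - 12483/2000 * h ^ 12 + 459/1000 * h ^ 13"
  have "outer_path_defect t = t * p"
    unfolding outer_path_defect_def outer_base_def outer_slope_def weight_def recip_path_def p_def t_eq
    by algebra
  moreover have "0 \<le> p"
  proof -
    have halve: "h ^ Suc n \<le> 1/2 * h ^ n" for n
      using mult_right_mono[of h "1/2" "h ^ n"] h_bounds by simp
    have "h ^ 2 \<le> 1/2 * h" using halve[of 1] by (simp add: power2_eq_square)
    moreover have "h ^ 3 \<le> 1/2 * h ^ 2" "h ^ 4 \<le> 1/2 * h ^ 3" "h ^ 5 \<le> 1/2 * h ^ 4"
      "h ^ 6 \<le> 1/2 * h ^ 5" "h ^ 7 \<le> 1/2 * h ^ 6" "h ^ 8 \<le> 1/2 * h ^ 7" "h ^ 12 \<le> 1/2 * h ^ 11"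
      using halve[of 2] halve[of 3] halve[of 4] halve[of 5] halve[of 6] halve[of 7] halve[of 11]
      by simp_all
    moreover have "0 \<le> h ^ 9" "0 \<le> h ^ 10" "0 \<le> h ^ 11" "0 \<le> h ^ 13" using h_bounds by auto
    ultimately show ?thesis unfolding p_def using h_bounds by linarith
  qed
  ultimately show ?thesis using assms by simp
qed

lemma outer_path_defect_nonneg_far:
  assumes "1 \<le> t" shows "0 \<le> outer_path_defect t"
proof -
  define h where "h = t - 1"
  have h_nonneg: "0 \<le> h" and t_eq: "t = 1 + h" using assms by (auto simp: h_def)
  have "outer_path_defect t = t * (6407223/80000000 + 158964807/800000000 * h
      + 2065347171/800000000 * h ^ 2 + 127839291369/4000000000 * h ^ 3 + 332547083883/2000000000 * h ^ 4
      + 1940562257507/4000000000 * h ^ 5 + 3586754892381/4000000000 * h ^ 6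
      + 4391305403401/4000000000 * h ^ 7 + 110562693563/125000000 * h ^ 8 + 218283345357/500000000 * h ^ 9
      + h ^ 10 * (459/1000 * h * (h - 4)\<^sup>2 + 207/500 * (h - 21/2)\<^sup>2 + 116661723/2000000 + 44829/2000000 * h))"
    unfolding outer_path_defect_def outer_base_def outer_slope_def weight_def recip_path_def t_eq
    by algebra
  also have "\<dots> \<ge> 0" using h_nonneg assms by (intro add_nonneg_nonneg mult_nonneg_nonneg) auto
  finally show ?thesis .
qed

lemma recip_path_ge_4_5: assumes "1/2 \<le> t" shows "4/5 \<le> recip_path t"
proof -
  have "(1/2)\<^sup>2 \<le> t\<^sup>2" using assms by (intro power_mono) auto
  then show ?thesis using recip_path_ge[of t] by (simp add: power2_eq_square)
qed

lemma recip_path_ge_5: assumes "1 \<le> t" shows "5 \<le> recip_path t"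
proof -
  have "(1/2)\<^sup>2 \<le> (t - 1/2)\<^sup>2" "1\<^sup>2 \<le> t\<^sup>2" using assms by (auto intro!: power_mono)
  then have "1 * 5 \<le> t\<^sup>2 * (323/100 + 15/2 * (t - 1/2)\<^sup>2)"
    by (intro mult_mono) (auto simp: power2_eq_square)
  then show ?thesis by (simp add: recip_path_def)
qed

lemma outer_defect_recip_path:
  assumes "1/2 \<le> t" shows "0 \<le> outer_defect t (1 / recip_path t)"
proof -
  have "outer_defect t (1 / recip_path t) = outer_path_defect t / (recip_path t)\<^sup>2"
    unfolding outer_defect_def outer_path_defect_def using recip_path_ge_4_5[OF assms]
    by (simp add: field_simps power2_eq_square)
  moreover have "0 \<le> outer_path_defect t"
    using outer_path_defect_nonneg_mid[of t] outer_path_defect_nonneg_far[of t] assms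
    by (cases "t \<le> 1") auto
  ultimately show ?thesis by simp
qed

context ground_state begin

lemma weight_tau_less_if_tau_le:
  assumes "tau \<le> 243/500" shows "weight tau * (Q tau)\<^sup>2 < 1"
proof -
  define s where "s = 381/5000 + 9899/10000 * tau"
  have s_pos: "0 < s" using tau_pos by (simp add: s_def)
  have "1 * (K tau - K_barrier 1 (1/10) (47/2000) tau (zeta tau)) \<le> 0"
  proof (rule K_barrier_comparison[where d = "1/4"])
    fix r assume tau_le_r: "tau \<le> r"
    then have r_bounds: "0 < r" "41/100 \<le> r" using tau_ge by auto
    show "1/4 \<le> 1 * r + 1/10 - 47/2000 * zeta r" using zeta_less[OF tau_le_r] r_bounds by simp
    show "1 * barrier_defect 1 (1/10) (47/2000) r (zeta r) \<le> 0"
      using barrier_defect_high_nonpos[OF r_bounds(2), of "zeta r"] zeta_pos[OF r_bounds(1)]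
        zeta_le[OF tau_le_r]
        zeta_mult_t_sq_le[OF tau_le_r] assms by simp
  qed auto
  then have "K tau \<le> 2 * zeta tau / (1 * tau + 1/10 - 47/2000 * zeta tau)"
    by (simp add: K_barrier_def)
  also have "\<dots> \<le> 2 * (1011/1000 + 429/1000 * tau) / s"
    using zeta_le[OF order_refl] s_pos tau_pos by (intro frac_le) (auto simp: s_def)
  finally have K_mult_le: "K tau * s \<le> 2 * (1011/1000 + 429/1000 * tau)"
    using s_pos by (simp add: pos_le_divide_eq)
  have "tau\<^sup>2 \<le> (243/500)\<^sup>2" using assms tau_pos by (intro power_mono) auto
  then have "446/1000 \<le> kappa" using kappa_ge tau_ge by (simp add: power2_eq_square)
  then have "(446/1000)\<^sup>2 \<le> kappa\<^sup>2" by (intro power_mono) auto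
  then have "1989/10000 * tau\<^sup>2 \<le> kappa\<^sup>2 * tau\<^sup>2"
    by (intro mult_right_mono) (auto simp: power2_eq_square)
  then have "(2 - 2 * kappa\<^sup>2 * tau\<^sup>2) * s \<le> (2 - 1989/5000 * tau\<^sup>2) * s"
    using s_pos by (intro mult_right_mono) auto
  moreover have "(Q tau)\<^sup>2 * s = (2 - 2 * kappa\<^sup>2 * tau\<^sup>2) * s + K tau * s"
    unfolding Q_sq_eq[OF tau_pos] zeta_tau by algebra
  ultimately have "weight tau * ((Q tau)\<^sup>2 * s)
      \<le> weight tau * ((2 - 1989/5000 * tau\<^sup>2) * s + 2 * (1011/1000 + 429/1000 * tau))"
    using K_mult_le weight_pos[of tau] tau_pos by (intro mult_left_mono) auto
  also have "\<dots> < s" using weight_start_outer[OF tau_ge assms] by (simp add: s_def)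
  finally have "weight tau * (Q tau)\<^sup>2 * s < 1 * s" by (simp add: mult.assoc)
  then show ?thesis using s_pos by (simp only: mult_less_cancel_right_pos)
qed

lemma weight_tau_less: "weight tau * (Q tau)\<^sup>2 < 1"
proof (cases "tau \<le> 243/500")
  case False
  have "weight tau * (u tau)\<^sup>2
      \<le> weight tau * (689/500 + 1011/2500 * tau\<^sup>2 + 1773/10000 * tau ^ 4)"
    using u_tau_sq_le tau_ge weight_pos[of tau] tau_pos by (intro mult_left_mono) auto
  also have "\<dots> < tau\<^sup>2" using weight_start_inner[of tau] False tau_less by simp
  finally have "tau\<^sup>2 * (weight tau * (Q tau)\<^sup>2) < tau\<^sup>2 * 1"
    by (simp add: u_def power_mult_distrib mult.left_commute)
  then show ?thesis using tau_pos by (simp only: mult_less_cancel_left_pos zero_less_power)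
qed (rule weight_tau_less_if_tau_le)

lemma outer_defect_zeta_nonneg: assumes tau_le_t: "tau \<le> t" shows "0 \<le> outer_defect t (zeta t)"
proof (cases "t \<le> 251/500")
  case True
  have t_bounds: "41/100 \<le> t" "t \<le> 1" using tau_ge tau_le_t True by auto
  have "0 \<le> zeta t" using zeta_pos[of t] t_bounds by simp
  from outer_defect_nonneg_below_near[OF t_bounds this zeta_le_const[OF tau_le_t] _ _
      outer_defect_near[OF t_bounds(1) True]]
  show ?thesis by simp
next
  case False
  then have t_bounds: "251/500 \<le> t" "1/2 \<le> t" by auto
  have recip: "0 < recip_path t" "4/5 \<le> recip_path t"
    using recip_path_ge_4_5[OF t_bounds(2)] by auto
  have zeta: "0 \<le> zeta t" using zeta_pos[of t] t_bounds by simp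
  have zeta_le: "zeta t \<le> 1 / recip_path t"
    using recip_path_mult_zeta_le_1[OF t_bounds(1)] recip(1)
    by (simp add: pos_le_divide_eq mult.commute)
  have inv_pos: "0 < 1 / recip_path t" using recip(1) by simp
  note defect = outer_defect_recip_path[OF t_bounds(2)]
  show ?thesis
  proof (cases "t \<le> 1")
    case True
    have "1 / recip_path t \<le> 1 / (4/5)" using recip by (intro divide_left_mono) auto
    then have "1 / recip_path t \<le> 5/4" by simp
    from outer_defect_nonneg_below_near[OF _ True zeta zeta_le inv_pos this defect] t_bounds
    show ?thesis by simp
  next
    case False
    then have t_ge_1: "1 \<le> t" by simp
    have "1 / recip_path t \<le> 1 / 5"
      using recip_path_ge_5[OF t_ge_1] recip(1) by (intro divide_left_mono) auto
    from outer_defect_nonneg_below_far[OF t_ge_1 zeta zeta_le inv_pos this defect]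
    show ?thesis .
  qed
qed

definition outer_sup where "outer_sup t = 1 - weight t * (Q t)\<^sup>2"

definition douter_sup where
  "douter_sup t = (Q t)\<^sup>2 * (2 * weight t * (1 - zeta t + 1 / t) - dweight t)"

definition defect where
  "defect t = ddweight t - 4 * (1 - zeta t + 1 / t) * dweight t
    + weight t * (4 + K t + 8 * (1 - zeta t) / t + 6 / t\<^sup>2) - 3"

definition ddouter_sup where "ddouter_sup t = - ((Q t)\<^sup>2 * (defect t + 3 * outer_sup t))"

lemma outer_sup_deriv: assumes "0 < t" shows "(outer_sup has_real_derivative douter_sup t) (at t)"
  unfolding outer_sup_def[abs_def] douter_sup_def
  by (rule DERIV_cong, (rule weight_deriv Q_sq_deriv[OF assms] derivative_intros)+)
    (simp add: algebra_simps)

lemma douter_sup_deriv: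
  assumes "0 < t" shows "(douter_sup has_real_derivative ddouter_sup t) (at t)"
proof -
  define y where "y = 1 / t"
  let ?S = "(Q t)\<^sup>2"
  let ?dd = "2 * ?S * (zeta t - 1 - y) * (2 * weight t * (1 - zeta t + y) - dweight t)
     + ?S * (2 * dweight t * (1 - zeta t + y)
       + 2 * weight t * (zeta t * (2 - zeta t) + K t - y\<^sup>2) - ddweight t)"
  have recip_deriv: "((\<lambda>t. 1 / t) has_real_derivative - y\<^sup>2) (at t)"
    using assms by (auto intro!: derivative_eq_intros simp: y_def power2_eq_square)
  have "(douter_sup has_real_derivative ?dd) (at t)"
    unfolding douter_sup_def[abs_def]
    by (rule DERIV_cong, (rule weight_deriv dweight_deriv recip_deriv Q_sq_deriv[OF assms] zeta_deriv[OF assms]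
        derivative_intros)+) (simp add: y_def algebra_simps)
  moreover have "defect t = ddweight t - 4 * (1 - zeta t + y) * dweight t
      + weight t * (4 + K t + 8 * (1 - zeta t) * y + 6 * y\<^sup>2) - 3"
    by (simp add: defect_def y_def power_one_over)
  then have "?dd = ddouter_sup t"
    unfolding ddouter_sup_def outer_sup_def using Q_sq_eq[OF assms] by algebra
  ultimately show ?thesis by simp
qed

lemma defect_nonneg: assumes tau_le_t: "tau \<le> t" shows "0 \<le> defect t"
proof -
  have t_bounds: "0 < t" "41/100 \<le> t" using tau_le_t tau_ge by auto
  define s where "s = 51/50 * t + 31/200 - 1/20 * zeta t"
  have s_pos: "0 < s" using zeta_less[OF tau_le_t] t_bounds by (simp add: s_def)
  have "2 * zeta t \<le> K t * s"
    using K_ge_low_barrier[OF tau_le_t t_bounds(2)] s_pos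
    by (simp add: K_barrier_def s_def pos_divide_le_eq)
  then have "t\<^sup>2 * weight t * (2 * zeta t) \<le> t\<^sup>2 * weight t * (K t * s)"
    using weight_pos[of t] t_bounds by (intro mult_left_mono) auto
  moreover have "t\<^sup>2 * defect t = t\<^sup>2 * ddweight t - 4 * (t\<^sup>2 * (1 - zeta t) + t) * dweight t
      + weight t * (4 * t\<^sup>2 + t\<^sup>2 * K t + 8 * (1 - zeta t) * t + 6) - 3 * t\<^sup>2"
    unfolding defect_def using t_bounds by (simp add: field_simps power2_eq_square)
  then have "s * (t\<^sup>2 * defect t)
      = outer_defect t (zeta t) + t\<^sup>2 * weight t * (K t * s) - t\<^sup>2 * weight t * (2 * zeta t)"
    unfolding outer_defect_def outer_base_eq outer_slope_eq s_def by algebra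
  ultimately have "0 \<le> s * (t\<^sup>2 * defect t)" using outer_defect_zeta_nonneg[OF tau_le_t] by linarith
  then show ?thesis using s_pos t_bounds by (simp add: zero_le_mult_iff)
qed

lemma douter_sup_nonneg: assumes tau_le_t: "tau \<le> t" shows "0 \<le> douter_sup t"
proof -
  have t_bounds: "0 < t" "41/100 \<le> t" using tau_le_t tau_ge by auto
  have "1 \<le> 1 - zeta t + 1 / t"
    using zeta_mult_t_le[OF tau_le_t] t_bounds by (simp add: field_simps)
  then have "2 * weight t * 1 \<le> 2 * weight t * (1 - zeta t + 1 / t)"
    using weight_pos[of t] t_bounds by (intro mult_left_mono) auto
  then show ?thesis using dweight_le[OF t_bounds(2)] by (simp add: douter_sup_def)
qed

lemma outer_sup_mono: assumes "tau \<le> t" shows "outer_sup tau \<le> outer_sup t"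
proof (rule DERIV_nonneg_imp_nondecreasing[OF assms])
  show "\<exists>y. (outer_sup has_real_derivative y) (at x) \<and> 0 \<le> y" if "tau \<le> x" for x
    using outer_sup_deriv[of x] douter_sup_nonneg[of x] that tau_pos by auto
qed

lemma outer_sup_tau_pos: "0 < outer_sup tau"
  using weight_tau_less by (simp add: outer_sup_def)

lemma outer_sup_le_1: "0 \<le> t \<Longrightarrow> outer_sup t \<le> 1"
  using weight_pos[of t] by (simp add: outer_sup_def)

lemma shifted_solution_growth:
  assumes ode: "solves_lin_ode (\<lambda>t. Q (t + s)) f df" and init: "f 0 = 0" "df 0 = 1"
    and tau_le_s: "tau \<le> s" and t_pos: "0 < t"
  shows "(outer_sup tau)\<^sup>2 * t \<le> f t"
proof (rule linear_growth_if_supersolution[OF ode init])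
  have shift: "((\<lambda>x. outer_sup (x + s)) has_real_derivative douter_sup (x + s)) (at x)"
      "((\<lambda>x. douter_sup (x + s)) has_real_derivative ddouter_sup (x + s)) (at x)" if "0 \<le> x" for x
    using outer_sup_deriv[of "x + s"] douter_sup_deriv[of "x + s"] that tau_le_s tau_pos
    by (auto simp: DERIV_shift)
  then show "continuous_on {0..} (\<lambda>x. outer_sup (x + s))" "continuous_on {0..} (\<lambda>x. douter_sup (x + s))"
    by (auto intro!: continuous_at_imp_continuous_on dest: DERIV_isCont)
  fix x :: real assume x_bounds: "0 \<le> x"
  show "outer_sup tau \<le> outer_sup (x + s)" using outer_sup_mono tau_le_s x_bounds by simp
  show "outer_sup (x + s) \<le> 1" using outer_sup_le_1 tau_le_s x_bounds tau_pos by simp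
next
  fix x :: real assume x_bounds: "0 < x"
  then have "tau \<le> x + s" using tau_le_s by simp
  then have "0 \<le> (Q (x + s))\<^sup>2 * defect (x + s)" using defect_nonneg by simp
  then show "ddouter_sup (x + s) + 3 * (Q (x + s))\<^sup>2 * outer_sup (x + s) \<le> 0"
    by (simp add: ddouter_sup_def algebra_simps)
  show "((\<lambda>x. outer_sup (x + s)) has_real_derivative douter_sup (x + s)) (at x)"
    "((\<lambda>x. douter_sup (x + s)) has_real_derivative ddouter_sup (x + s)) (at x)"
    using outer_sup_deriv[of "x + s"] douter_sup_deriv[of "x + s"] x_bounds tau_le_s tau_pos
    by (auto simp: DERIV_shift)
qed (use t_pos outer_sup_tau_pos in auto)

end

theorem theorem6p1:
  fixes Q dQ F0 dF0 q dq :: "real \<Rightarrow> real" and t0 :: real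
  assumes "ground_state_profile Q dQ"
    and "solves_lin_ode Q F0 dF0" and "F0 0 = 0" and "dF0 0 = -1"
    and "t0 > 0" and "F0 t0 = 0" and "\<forall>t. 0 < t \<and> t < t0 \<longrightarrow> F0 t \<noteq> 0"
    and "solves_lin_ode (\<lambda>t. Q (t + t0)) q dq" and "q 0 = 0" and "dq 0 = 1"
  shows "(\<forall>t>0. q t > 0) \<and> (\<exists>c0>0. \<forall>t\<ge>1. q t / t \<ge> c0)"
proof -
  interpret ground_state Q dQ by unfold_locales (rule assms(1))
  define m where "m = (outer_sup tau)\<^sup>2"
  have m_pos: "0 < m" using outer_sup_tau_pos by (simp add: m_def)
  have "tau \<le> t0" using assms(7) by (intro tau_le_first_zero[OF assms(2-6)]) auto
  then have growth: "m * t \<le> q t" if "0 < t" for t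
    using shifted_solution_growth[OF assms(8-10) _ that] by (simp add: m_def)
  have "0 < q t" if "0 < t" for t
    using growth[OF that] mult_pos_pos[OF m_pos that] by linarith
  moreover have "m \<le> q t / t" if "1 \<le> t" for t
    using growth[of t] that by (simp add: pos_le_divide_eq)
  ultimately show ?thesis using m_pos by blast
qed

end
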